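(* Let $\lambda=\dfrac{221-43\sqrt{17}}{64}$ and $r_0=\dfrac{\sqrt{17}-3}{4}$. Let $f(z)=\sum_{n=0}^{\infty}a_nz^n$ be analytic in the unit disk $\mathbb{D}$ with $|f(z)|\le 1$ for all $z\in\mathbb{D}$. Then for all $z$ with $|z|=r\le r_0$, $$|f(z)|+|f'(z)|\,r+\sum_{n=2}^{\infty}|a_n|r^n+\left(\frac{1}{1+|a_0|}+\frac{r}{1-r}\right)\sum_{n=1}^{\infty}|a_n|^2r^{2n}+\lambda\,\frac{S_r}{\pi-S_r}\le 1 .$$ Moreover, the numbers $\lambda$ and $r_0$ are sharp: $\lambda$ cannot be replaced by any larger constant (with the inequality still holding for all such $f$ and all $|z|=r\le r_0$), and, with this $\lambda$, $r_0$ cannot be replaced by any larger radius (with the inequality still holding for all such $f$).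
   Context: $\mathbb{D}=\{z\in\mathbb{C}:|z|<1\}$ and $\mathbb{D}_r=\{z:|z|<r\}$. For $f(z)=\sum_{n\ge0}a_nz^n$ analytic in $\mathbb{D}$ and $0<r<1$, $$S_r=S_r(f)=\int_{\mathbb{D}_r}|f'(z)|^2\,dA(z)=\pi\sum_{n=1}^{\infty}n|a_n|^2r^{2n},$$ where $dA$ is planar Lebesgue measure (area counted with multiplicity); for $r=0$, $S_0=0$. *)

theory Defs
  imports "HOL-Complex_Analysis.Complex_Analysis"
begin

definition bounded_series :: "(complex \<Rightarrow> complex) \<Rightarrow> (nat \<Rightarrow> complex) \<Rightarrow> bool" where
  "bounded_series f a \<longleftrightarrow>
     f analytic_on ball 0 1 \<and>
     (\<forall>z\<in>ball 0 1. (\<lambda>n. a n * z ^ n) sums f z) \<and>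
     (\<forall>z\<in>ball 0 1. cmod (f z) \<le> 1)"

text \<open>The area, counted with multiplicity, of the image of the disk of radius \<open>r\<close>; \<open>lborel\<close> on the
  complex numbers is planar Lebesgue measure.\<close>

definition image_area :: "(complex \<Rightarrow> complex) \<Rightarrow> real \<Rightarrow> real" where
  "image_area f r = (LINT z:ball 0 r|lborel. (cmod (deriv f z))\<^sup>2)"

text \<open>The series over \<open>n \<ge> 2\<close> and \<open>n \<ge> 1\<close> are reindexed from \<open>0\<close>.\<close>

definition bohr_lhs ::
  "real \<Rightarrow> (complex \<Rightarrow> complex) \<Rightarrow> (nat \<Rightarrow> complex) \<Rightarrow> complex \<Rightarrow> real" where
  "bohr_lhs \<mu> f a z = (let r = cmod z in
     cmod (f z) + cmod (deriv f z) * r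
     + (\<Sum>n. cmod (a (n + 2)) * r ^ (n + 2))
     + (1 / (1 + cmod (a 0)) + r / (1 - r)) * (\<Sum>n. (cmod (a (n + 1)))\<^sup>2 * r ^ (2 * (n + 1)))
     + \<mu> * (image_area f r / (pi - image_area f r)))"

definition lambda_const :: real where
  "lambda_const = (221 - 43 * sqrt 17) / 64"

definition r0_const :: real where
  "r0_const = (sqrt 17 - 3) / 4"

end

theory Submission
  imports Defs
begin

text \<open>Let \<open>A = \<bar>a\<^sub>0\<bar>\<close>. Schwarz--Pick bounds \<open>\<bar>f\<bar> + r \<bar>f'\<bar>\<close>, and the inequalities of Carlson,
  \<open>\<bar>a\<^sub>2\<^sub>n\<^sub>+\<^sub>1\<bar> \<le> 1 - \<bar>a\<^sub>0\<bar>\<^sup>2 - \<dots> - \<bar>a\<^sub>n\<bar>\<^sup>2\<close> and its analogue for \<open>a\<^sub>2\<^sub>n\<close>, make the two series together at most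
  \<open>(1 - A\<^sup>2) r\<^sup>2 / (1 - r)\<close>. For the area the crude bound \<open>\<bar>a\<^sub>n\<bar> \<le> 1 - A\<^sup>2\<close> suffices, because the inequality is
  only tight as \<open>A \<rightarrow> 1\<close>. What remains is an inequality in \<open>A\<close> and \<open>r\<close>, monotone in \<open>r\<close>, that at \<open>r = r\<^sub>0\<close>
  reduces to a polynomial with a triple zero at \<open>A = 1\<close>. The maps \<open>(A + z) / (1 + A z)\<close> with \<open>A \<rightarrow> 1\<close> show
  that both constants are sharp. All \<open>L\<^sup>2\<close> arguments use area integrals over disks instead of circle integrals,
  so that orthogonality of the powers of \<open>z\<close> comes from the rotation invariance of Lebesgue measure.\<close>

section \<open>Area integrals of power series over disks\<close>

text \<open>Put e = 1 - A. The bounds for all terms except the area quotient add up to 1 minus a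
  multiple of e, and as e tends to 0 the factor tends to (1 + r^2) (1 - 3 r - 2 r^2) / ((1 + r)^2 (1
  - r)). Its positive zero is r_0, so the radius is decided at first order, while the area quotient
  is of order e^2. At r = r_0 the first order is gone, and lambda is fixed by what the e^2 term
  leaves room for. Bounding every coefficient by 1 - A^2, where the Moebius maps have (1 - A^2)
  A^(n-1), changes the area term only at order e^3, where a positive margin remains. The weight 1/(1
  + A) + r/(1 - r) is exactly the total amount by which |a_k|^2 lowers Carlson's bounds from index
  2k on, so the two series balance without loss. Carlson's inequalities in turn rest on one fact,
  that multiplication by f does not increase norms, tested on suitable vectors.\<close>

lemma lborel_complex_eq_distr:
  "(lborel :: complex measure) = distr (lborel \<Otimes>\<^sub>M lborel) borel (\<lambda>(x, y). Complex x y)"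
proof (rule lborel_eqI)
  have [measurable]: "(\<lambda>p. Complex (fst p) (snd p)) \<in> borel_measurable (borel \<Otimes>\<^sub>M borel)"
    unfolding borel_prod Complex_eq
    by (intro borel_measurable_continuous_onI continuous_intros)
  have m: "(\<lambda>(x, y). Complex x y) \<in> (lborel \<Otimes>\<^sub>M lborel) \<rightarrow>\<^sub>M borel"
    by (simp add: case_prod_beta)
  fix l u :: complex assume le: "\<And>b. b \<in> Basis \<Longrightarrow> l \<bullet> b \<le> u \<bullet> b"
  have eq: "(\<lambda>(x, y). Complex x y) -` box l u \<inter> space (lborel \<Otimes>\<^sub>M lborel)
      = {Re l<..<Re u} \<times> {Im l<..<Im u}"
    by (auto simp: space_pair_measure in_box_complex_iff)
  have re: "Re l \<le> Re u" and im: "Im l \<le> Im u"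
    using le[of 1] le[of \<i>] by (auto simp: Basis_complex_def)
  show "emeasure (distr (lborel \<Otimes>\<^sub>M lborel) borel (\<lambda>(x, y). Complex x y)) (box l u)
      = (\<Prod>b\<in>Basis. (u - l) \<bullet> b)"
    using re im
    by (simp add: emeasure_distr[OF m] eq lborel.emeasure_pair_measure_Times Basis_complex_def
        ennreal_mult)
qed simp

text \<open>Both orders of integration are kept because a horizontal shear is a translation in the
  inner \<open>x\<close>-integral and a vertical shear one in the inner
  \<open>y\<close>-integral.\<close>

lemma nn_integral_lborel_complex:
  fixes h :: "complex \<Rightarrow> ennreal"
  assumes [measurable]: "h \<in> borel_measurable borel"
  shows "(\<integral>\<^sup>+z. h z \<partial>lborel) = (\<integral>\<^sup>+y. (\<integral>\<^sup>+x. h (Complex x y) \<partial>lborel) \<partial>lborel)"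
    and "(\<integral>\<^sup>+z. h z \<partial>lborel) = (\<integral>\<^sup>+x. (\<integral>\<^sup>+y. h (Complex x y) \<partial>lborel) \<partial>lborel)"
proof -
  have [measurable]: "(\<lambda>p. Complex (fst p) (snd p)) \<in> borel_measurable (borel \<Otimes>\<^sub>M borel)"
    unfolding borel_prod Complex_eq
    by (intro borel_measurable_continuous_onI continuous_intros)
  have *: "(\<integral>\<^sup>+z. h z \<partial>lborel) = (\<integral>\<^sup>+p. h (Complex (fst p) (snd p)) \<partial>(lborel \<Otimes>\<^sub>M lborel))"
    by (subst lborel_complex_eq_distr, subst nn_integral_distr) (simp_all add: case_prod_beta)
  show "(\<integral>\<^sup>+z. h z \<partial>lborel) = (\<integral>\<^sup>+y. (\<integral>\<^sup>+x. h (Complex x y) \<partial>lborel) \<partial>lborel)"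
    unfolding * by (subst lborel_pair.nn_integral_snd[symmetric]) (simp_all add: case_prod_beta)
  show "(\<integral>\<^sup>+z. h z \<partial>lborel) = (\<integral>\<^sup>+x. (\<integral>\<^sup>+y. h (Complex x y) \<partial>lborel) \<partial>lborel)"
    unfolding * by (subst lborel.nn_integral_fst[symmetric]) (simp_all)
qed

lemma nn_integral_lborel_shift:
  fixes h :: "real \<Rightarrow> ennreal"
  assumes [measurable]: "h \<in> borel_measurable borel"
  shows "(\<integral>\<^sup>+x. h (x + t) \<partial>lborel) = (\<integral>\<^sup>+x. h x \<partial>lborel)"
  using nn_integral_real_affine[of h 1 t] by (simp add: add.commute)

lemma nn_integral_lborel_complex_shear:
  fixes h :: "complex \<Rightarrow> ennreal" and t :: real
  assumes [measurable]: "h \<in> borel_measurable borel"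
  shows "(\<integral>\<^sup>+z. h (z + of_real (t * Im z)) \<partial>lborel) = (\<integral>\<^sup>+z. h z \<partial>lborel)"
    and "(\<integral>\<^sup>+z. h (z + \<i> * of_real (t * Re z)) \<partial>lborel) = (\<integral>\<^sup>+z. h z \<partial>lborel)"
proof -
  have [measurable]: "(\<lambda>x. Complex x y) \<in> borel_measurable borel"
    "(\<lambda>y. Complex x y) \<in> borel_measurable borel" for x y
    unfolding Complex_eq by measurable
  have e: "Complex x y + of_real (t * y) = Complex (x + t * y) y"
    "Complex x y + \<i> * of_real (t * x) = Complex x (y + t * x)" for x y
    by (simp_all add: complex_eq_iff)
  show "(\<integral>\<^sup>+z. h (z + of_real (t * Im z)) \<partial>lborel) = (\<integral>\<^sup>+z. h z \<partial>lborel)"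
    by (simp add: nn_integral_lborel_complex(1) e del: of_real_mult add: nn_integral_lborel_shift[where h = "\<lambda>x. h (Complex x _)"])
  show "(\<integral>\<^sup>+z. h (z + \<i> * of_real (t * Re z)) \<partial>lborel) = (\<integral>\<^sup>+z. h z \<partial>lborel)"
    by (simp add: nn_integral_lborel_complex(2) e del: of_real_mult add: nn_integral_lborel_shift[where h = "\<lambda>y. h (Complex _ y)"])
qed

text \<open>A rotation other than \<open>\<plusminus>1\<close> is a product of three shears, and shears preserve area by Fubini.\<close>

lemma lborel_distr_rotation:
  fixes c :: complex
  assumes c: "cmod c = 1" "Im c \<noteq> 0"
  shows "distr lborel borel ((*) c) = lborel"
proof (rule measure_eqI)
  fix A :: "complex set" assume "A \<in> sets (distr lborel borel ((*) c))"
  then have [measurable]: "A \<in> sets borel" by simp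
  \<comment> \<open>For \<open>c = cis x\<close> this is - tan (x / 2), the slope of the two outer
    shears; the middle one has slope sin x.\<close>
  define t where "t = (Re c - 1) / Im c"
  define h :: "complex \<Rightarrow> ennreal" where "h = indicator A"
  have [measurable]: "h \<in> borel_measurable borel" by (simp add: h_def)
  have sq: "(Re c)\<^sup>2 + (Im c)\<^sup>2 = 1"
    using c by (metis cmod_power2 one_power2)
  have tq: "t * Im c = Re c - 1" using c by (simp add: t_def)
  have tp: "t * (Re c + 1) = - Im c"
    using c sq by (simp add: t_def field_simps power2_eq_square)
  define S where "S = (\<lambda>z. z + of_real (t * Im z))"
  define T where "T = (\<lambda>z. z + \<i> * of_real (Im c * Re z))"
  have [measurable]: "S \<in> borel_measurable borel" "T \<in> borel_measurable borel"
    unfolding S_def T_def by measurable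
  have cz: "c * z = S (T (S z))" for z
  proof -
    have "Re (S (T (S z))) = Re c * Re z - Im c * Im z"
    proof -
      have "Re (S (T (S z))) = Re z + t * Im z + t * (Im z + Im c * (Re z + t * Im z))"
        by (simp add: S_def T_def)
      also have "\<dots> = Re z * (1 + t * Im c) + Im z * (t * (2 + t * Im c))"
        by (simp add: algebra_simps)
      also have "\<dots> = Re z * Re c + Im z * (t * (Re c + 1))"
        unfolding tq by (simp add: add.commute)
      finally show ?thesis unfolding tp by simp
    qed
    moreover have "Im (S (T (S z))) = Re c * Im z + Im c * Re z"
    proof -
      have "Im (S (T (S z))) = Im z * (1 + t * Im c) + Im c * Re z"
        by (simp add: S_def T_def algebra_simps)
      then show ?thesis unfolding tq by simp
    qed
    ultimately show ?thesis by (simp add: complex_eq_iff)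
  qed
  have "emeasure (distr lborel borel ((*) c)) A = (\<integral>\<^sup>+z. h z \<partial>distr lborel borel ((*) c))"
    by (simp add: h_def)
  also have "\<dots> = (\<integral>\<^sup>+z. h (S (T (S z))) \<partial>lborel)"
    by (subst nn_integral_distr) (simp_all add: cz)
  also have "\<dots> = (\<integral>\<^sup>+z. h (S (T z)) \<partial>lborel)"
    using nn_integral_lborel_complex_shear(1)[of "\<lambda>z. h (S (T z))" t] by (simp add: S_def)
  also have "\<dots> = (\<integral>\<^sup>+z. h (S z) \<partial>lborel)"
    using nn_integral_lborel_complex_shear(2)[of "\<lambda>z. h (S z)" "Im c"] by (simp add: T_def)
  also have "\<dots> = (\<integral>\<^sup>+z. h z \<partial>lborel)"
    using nn_integral_lborel_complex_shear(1)[of h t] by (simp add: S_def)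
  also have "\<dots> = emeasure lborel A" by (simp add: h_def)
  finally show "emeasure (distr lborel borel ((*) c)) A = emeasure lborel A" .
qed simp

lemma integral_ball_rotation:
  fixes h :: "complex \<Rightarrow> complex"
  assumes c: "cmod c = 1" "Im c \<noteq> 0" and [measurable]: "h \<in> borel_measurable borel"
  shows "(LINT z:ball 0 \<rho>|lborel. h (c * z)) = (LINT z:ball 0 \<rho>|lborel. h z)"
proof -
  have [measurable]: "ball (0::complex) \<rho> \<in> sets borel" by simp
  have "(LINT z:ball 0 \<rho>|lborel. h z)
      = (LINT z|distr lborel borel ((*) c). indicator (ball 0 \<rho>) z *\<^sub>R h z)"
    by (simp add: lborel_distr_rotation[OF c] set_lebesgue_integral_def)
  also have "\<dots> = (LINT z|lborel. indicator (ball 0 \<rho>) (c * z) *\<^sub>R h (c * z))"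
    by (subst integral_distr) simp_all
  also have "\<dots> = (LINT z:ball 0 \<rho>|lborel. h (c * z))"
    using c unfolding set_lebesgue_integral_def
    by (intro Bochner_Integration.integral_cong) (auto simp: indicator_def norm_mult)
  finally show ?thesis ..
qed

section \<open>Orthogonality and norms of the powers of z on a disk\<close>

lemma integrable_on_ball:
  fixes h :: "complex \<Rightarrow> 'b::{banach, second_countable_topology}"
  assumes "continuous_on (cball 0 \<rho>) h"
  shows "set_integrable lborel (ball 0 \<rho>) h"
proof -
  have "set_integrable lborel (cball 0 \<rho>) h"
    unfolding set_integrable_def using assms by (intro borel_integrable_compact) auto
  then show ?thesis
    by (rule set_integrable_subset) auto
qed

text \<open>Rotating by \<open>c\<close> multiplies the integrand by the constant
  \<open>cnj (c ^ (n - m))\<close> and leaves the integral unchanged, so the integral vanishes once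
  that constant is not 1.\<close>

lemma integral_ball_power_cnj_power_neq:
  fixes m n :: nat
  assumes "m < n"
  shows "(LINT z:ball 0 \<rho>|lborel. z ^ m * cnj z ^ n) = 0"
proof -
  define k where "k = n - m"
  \<comment> \<open>Makes \<open>c ^ k\<close> a quarter turn. A half turn would give c = -1 for k =
    1, which \<open>integral_ball_rotation\<close> excludes.\<close>
  define c where "c = cis (pi / (2 * real k))"
  have k: "k > 0" "n = m + k" using assms by (auto simp: k_def)
  have "sin (pi / (2 * real k)) > 0"
    by (rule sin_gt_zero) (use k in \<open>auto simp: field_simps\<close>)
  then have c: "cmod c = 1" "Im c \<noteq> 0" by (auto simp: c_def)
  have "c ^ k = cis (real k * (pi / (2 * real k)))" by (simp only: c_def Complex.DeMoivre)
  also have "real k * (pi / (2 * real k)) = pi / 2" using k by simp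
  finally have ck: "c ^ k = \<i>" by simp
  have cc: "c ^ m * cnj c ^ n = - \<i>"
  proof -
    have "c ^ m * cnj c ^ n = (c * cnj c) ^ m * cnj (c ^ k)"
      by (simp add: k(2) power_add power_mult_distrib)
    also have "c * cnj c = 1" using c by (simp add: complex_norm_square[symmetric])
    finally show ?thesis by (simp add: ck)
  qed
  let ?I = "LINT z:ball 0 \<rho>|lborel. z ^ m * cnj z ^ n"
  have "?I = (LINT z:ball 0 \<rho>|lborel. (c * z) ^ m * cnj (c * z) ^ n)"
    by (rule integral_ball_rotation[OF c, symmetric]) (intro borel_measurable_continuous_onI continuous_intros)
  also have "\<dots> = (LINT z:ball 0 \<rho>|lborel. (- \<i>) * (z ^ m * cnj z ^ n))"
    by (simp add: cc[symmetric] power_mult_distrib mult_ac)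
  also have "\<dots> = - \<i> * ?I" by (rule set_integral_mult_right)
  finally have I: "?I = - \<i> * ?I" .
  have "(1 + \<i>) * ?I = ?I - (- \<i> * ?I)" by (simp add: algebra_simps)
  also have "\<dots> = 0" unfolding I[symmetric] by simp
  finally have "(1 + \<i>) * ?I = 0" .
  moreover have "1 + \<i> \<noteq> 0" by (simp add: complex_eq_iff)
  ultimately show ?thesis by simp
qed

text \<open>Takes the place of polar coordinates: the part of the disk where
  \<open>(cmod z)\<^sup>2\<close> exceeds \<open>x\<close> is an annulus of area pi (rho^2 - x), and
  it suffices to compare the two measures on rays.\<close>

lemma distr_ball_norm_square:
  fixes \<rho> :: real
  assumes \<rho>: "\<rho> > 0"
  shows "distr (density lborel (indicator (ball (0::complex) \<rho>))) borel (\<lambda>z. (cmod z)\<^sup>2)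
    = density lborel (\<lambda>s. ennreal pi * indicator {0<..<\<rho>\<^sup>2} s)" (is "?M = ?N")
proof (rule measure_eqI_lessThan)
  have ball: "emeasure lborel (ball (0::complex) r) = ennreal (pi * r\<^sup>2)" 
    "emeasure lborel (cball (0::complex) r) = ennreal (pi * r\<^sup>2)" if "r \<ge> 0" for r
    using that by (simp_all add: emeasure_ball emeasure_cball unit_ball_vol_2)
  fix x :: real
  have [measurable]: "ball (0::complex) \<rho> \<in> sets borel" by simp
  have "emeasure ?M {x<..} = emeasure (density lborel (indicator (ball 0 \<rho>))) {z. x < (cmod z)\<^sup>2}"
    by (subst emeasure_distr) (auto simp: vimage_def)
  also have "\<dots> = emeasure lborel {z. cmod z < \<rho> \<and> x < (cmod z)\<^sup>2}"
    by (subst emeasure_density) (auto simp: nn_integral_indicator[symmetric] indicator_def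
        simp del: nn_integral_indicator intro!: nn_integral_cong)
  finally have M: "emeasure ?M {x<..} = emeasure lborel {z. cmod z < \<rho> \<and> x < (cmod z)\<^sup>2}" .
  have N: "emeasure ?N {x<..} = ennreal pi * emeasure lborel ({0<..<\<rho>\<^sup>2} \<inter> {x<..})"
    by (subst emeasure_density, simp, simp)
      (auto simp: nn_integral_cmult[symmetric] nn_integral_indicator[symmetric] indicator_def 
        simp del: nn_integral_indicator
        intro!: nn_integral_cong)
  show "emeasure ?M {x<..} = emeasure ?N {x<..}"
  proof (cases "x < 0")
    case True
    then have "{z. cmod z < \<rho> \<and> x < (cmod z)\<^sup>2} = ball 0 \<rho>"
      by (auto intro: less_le_trans)
    moreover have "{0<..<\<rho>\<^sup>2} \<inter> {x<..} = {0<..<\<rho>\<^sup>2}" using True by auto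
    ultimately show ?thesis using \<rho> by (simp add: M N ball ennreal_mult)
  next
    case False
    then have x: "x \<ge> 0" by simp
    show ?thesis
    proof (cases "x < \<rho>\<^sup>2")
      case True
      have lt: "sqrt x < \<rho>" using True x \<rho> by (simp add: real_less_lsqrt)
      have "x < (cmod z)\<^sup>2 \<longleftrightarrow> sqrt x < cmod z" for z
        using real_sqrt_less_iff[of x "(cmod z)\<^sup>2"] by (simp del: real_sqrt_less_iff)
      then have "{z. cmod z < \<rho> \<and> x < (cmod z)\<^sup>2} = ball 0 \<rho> - cball 0 (sqrt x)"
        by (intro set_eqI) (simp add: not_le)
      moreover have "emeasure lborel (ball (0::complex) \<rho> - cball 0 (sqrt x))
          = ennreal (pi * \<rho>\<^sup>2) - ennreal (pi * x)"
        using lt x \<rho> by (subst emeasure_Diff) (auto simp: ball)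
      moreover have "{0<..<\<rho>\<^sup>2} \<inter> {x<..} = {x<..<\<rho>\<^sup>2}" using x by auto
      ultimately show ?thesis using True x
        by (simp add: M N ennreal_minus ennreal_mult[symmetric] algebra_simps)
    next
      case False
      have "{z. cmod z < \<rho> \<and> x < (cmod z)\<^sup>2} = {}"
        using False \<rho> by (auto simp: not_less) (smt (verit) norm_ge_zero power_mono)
      moreover have "{0<..<\<rho>\<^sup>2} \<inter> {x<..} = {}" using False by auto
      ultimately show ?thesis by (simp only: M N emeasure_empty mult_zero_right)
    qed
  qed
  have "emeasure ?M {x<..} \<le> emeasure lborel (ball (0::complex) \<rho>)"
    unfolding M by (rule emeasure_mono) auto
  also have "\<dots> < \<infinity>" by (rule emeasure_lborel_ball_finite)
  finally show "emeasure ?M {x<..} < \<infinity>" .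
qed simp_all

lemma integral_ball_norm_power:
  assumes \<rho>: "\<rho> > 0"
  shows "(LINT z:ball 0 \<rho>|lborel. (cmod z) ^ (2 * n)) = pi * \<rho> ^ (2 * n + 2) / (n + 1)"
proof -
  have [measurable]: "ball (0::complex) \<rho> \<in> sets borel" by simp
  have "(LINT z:ball 0 \<rho>|lborel. (cmod z) ^ (2 * n))
      = (LINT z|density lborel (indicator (ball (0::complex) \<rho>)). ((cmod z)\<^sup>2) ^ n)"
    unfolding set_lebesgue_integral_def ennreal_indicator[symmetric]
    by (subst integral_density) (simp_all add: power_mult)
  also have "\<dots> = (LINT s|distr (density lborel (indicator (ball (0::complex) \<rho>))) borel
      (\<lambda>z. (cmod z)\<^sup>2). s ^ n)"
    by (subst integral_distr) simp_all
  also have "\<dots> = (LINT s|density lborel (\<lambda>s. ennreal (pi * indicator {0<..<\<rho>\<^sup>2} s)). s ^ n)"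
    by (simp add: distr_ball_norm_square[OF \<rho>] ennreal_mult ennreal_indicator)
  also have "\<dots> = (LINT s|lborel. pi * (s ^ n * indicator {0<..<\<rho>\<^sup>2} s))"
    by (subst integral_density) (simp_all add: mult_ac)
  also have "\<dots> = pi * (LINT s|lborel. s ^ n * indicator {0<..<\<rho>\<^sup>2} s)"
    by simp
  also have "(LINT s|lborel. s ^ n * indicator {0<..<\<rho>\<^sup>2} s)
      = (LINT s|lborel. s ^ n * indicator {0..\<rho>\<^sup>2} s)"
  proof (rule integral_cong_AE)
    have "AE s in lborel. s \<noteq> (0::real)" "AE s in lborel. s \<noteq> \<rho>\<^sup>2" 
      by (rule AE_lborel_singleton)+
    then show "AE s in lborel. s ^ n * indicator {0<..<\<rho>\<^sup>2} s = s ^ n * indicator {0..\<rho>\<^sup>2} s"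
      by eventually_elim (auto simp: indicator_def)
  qed simp_all
  also have "\<dots> = ((\<rho>\<^sup>2) ^ Suc n - 0 ^ Suc n) / Suc n"
    using integral_power[of 0 "\<rho>\<^sup>2" n] by simp
  finally show ?thesis by (simp add: power_mult[symmetric] power_add[symmetric] add.commute)
qed

lemma integral_ball_power_cnj_power:
  assumes \<rho>: "\<rho> > 0"
  shows "(LINT z:ball 0 \<rho>|lborel. z ^ m * cnj z ^ n)
    = (if m = n then of_real (pi * \<rho> ^ (2 * n + 2) / (n + 1)) else 0)"
proof (cases m n rule: linorder_cases)
  case less
  then show ?thesis by (simp add: integral_ball_power_cnj_power_neq)
next
  case greater
  have "cnj (LINT z:ball 0 \<rho>|lborel. z ^ n * cnj z ^ m)
      = (LINT z|lborel. cnj (indicator (ball 0 \<rho>) z *\<^sub>R (z ^ n * cnj z ^ m)))"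
    by (simp only: set_lebesgue_integral_def Bochner_Integration.integral_cnj)
  also have "\<dots> = (LINT z:ball 0 \<rho>|lborel. z ^ m * cnj z ^ n)"
    unfolding set_lebesgue_integral_def
    by (intro Bochner_Integration.integral_cong) (simp_all add: mult.commute)
  finally have "(LINT z:ball 0 \<rho>|lborel. z ^ m * cnj z ^ n)
      = cnj (LINT z:ball 0 \<rho>|lborel. z ^ n * cnj z ^ m)" ..
  then show ?thesis using greater by (simp add: integral_ball_power_cnj_power_neq)
next
  case equal
  have "z ^ n * cnj z ^ n = of_real (cmod z ^ (2 * n))" for z
    by (simp add: power_mult_distrib[symmetric] complex_norm_square[symmetric] power_mult)
  then show ?thesis
    using equal by (simp only: set_integral_complex_of_real integral_ball_norm_power[OF \<rho>]) simp
qed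

section \<open>Parseval's identity for power series on disks\<close>

lemma powser_abs_summable:
  fixes c :: "nat \<Rightarrow> complex"
  assumes sums: "\<And>z. cmod z < 1 \<Longrightarrow> (\<lambda>n. c n * z ^ n) sums g z" and z: "cmod z < 1"
  shows "summable (\<lambda>n. cmod (c n * z ^ n))"
proof (rule powser_insidea)
  let ?x = "complex_of_real ((1 + cmod z) / 2)"
  have n: "cmod ?x = (1 + cmod z) / 2" by (simp only: norm_of_real) simp
  show "summable (\<lambda>n. c n * ?x ^ n)"
    by (rule sums_summable, rule sums, subst n) (use z in simp)
  show "cmod z < cmod ?x" by (subst n) (use z in simp)
qed

lemma integral_ball_polynomial:
  fixes c :: "nat \<Rightarrow> complex"
  assumes \<rho>: "\<rho> > 0"
  shows "(LINT z:ball 0 \<rho>|lborel. (cmod (\<Sum>n<N. c n * z ^ n))\<^sup>2)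
    = pi * (\<Sum>n<N. (cmod (c n))\<^sup>2 * \<rho> ^ (2 * n + 2) / (n + 1))"
proof -
  let ?b = "\<lambda>z. indicator (ball (0::complex) \<rho>) z :: real"
  have int: "integrable lborel (\<lambda>z. ?b z *\<^sub>R (k * (z ^ m * cnj z ^ n)))" for m n k
    using integrable_on_ball[of \<rho> "\<lambda>z. k * (z ^ m * cnj z ^ n)"]
    by (simp add: set_integrable_def continuous_intros)
  have mon: "(LINT z|lborel. ?b z *\<^sub>R (k * (z ^ m * cnj z ^ n)))
      = k * (if m = n then of_real (pi * \<rho> ^ (2 * n + 2) / (n + 1)) else 0)" for m n k
  proof -
    have "(LINT z:ball 0 \<rho>|lborel. k * (z ^ m * cnj z ^ n)) = k * (LINT z:ball 0 \<rho>|lborel. z ^ m * cnj z ^ n)"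
      by (rule set_integral_mult_right)
    also note integral_ball_power_cnj_power[OF \<rho>]
    finally show ?thesis by (simp only: set_lebesgue_integral_def)
  qed
  have pt: "complex_of_real ((cmod (\<Sum>n<N. c n * z ^ n))\<^sup>2)
      = (\<Sum>m<N. \<Sum>n<N. (c m * cnj (c n)) * (z ^ m * cnj z ^ n))" for z
    unfolding complex_norm_square by (simp add: sum_product mult_ac)
  have "complex_of_real (LINT z:ball 0 \<rho>|lborel. (cmod (\<Sum>n<N. c n * z ^ n))\<^sup>2)
      = (LINT z:ball 0 \<rho>|lborel. complex_of_real ((cmod (\<Sum>n<N. c n * z ^ n))\<^sup>2))"
    by (rule set_integral_complex_of_real[symmetric])
  also have "\<dots> = (LINT z|lborel. (\<Sum>m<N. \<Sum>n<N. ?b z *\<^sub>R ((c m * cnj (c n)) * (z ^ m * cnj z ^ n))))"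
    unfolding set_lebesgue_integral_def
    by (intro Bochner_Integration.integral_cong)
       (simp_all only: pt scaleR_sum_right)
  also have "\<dots> = (\<Sum>m<N. \<Sum>n<N. (LINT z|lborel. ?b z *\<^sub>R ((c m * cnj (c n)) * (z ^ m * cnj z ^ n))))"
    by (simp only: Bochner_Integration.integral_sum Bochner_Integration.integrable_sum int)
  also have "\<dots> = (\<Sum>m<N. (c m * cnj (c m)) * of_real (pi * \<rho> ^ (2 * m + 2) / (m + 1)))"
    unfolding mon by (intro sum.cong refl) (simp add: if_distrib[of "\<lambda>x. _ * x"] cong: if_cong)
  also have "\<dots> = complex_of_real (pi * (\<Sum>n<N. (cmod (c n))\<^sup>2 * \<rho> ^ (2 * n + 2) / (n + 1)))"
    unfolding complex_norm_square[symmetric] by (simp add: sum_distrib_left mult_ac)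
  finally show ?thesis by (simp only: of_real_eq_iff)
qed

text \<open>The limit of \<open>integral_ball_polynomial\<close> by dominated convergence: since
  \<open>\<rho> < 1\<close>, the series converges absolutely at radius \<open>\<rho>\<close>, and
  one constant bounds all partial sums on the disk.\<close>

lemma parseval_ball:
  fixes c :: "nat \<Rightarrow> complex"
  assumes sums: "\<And>z. cmod z < 1 \<Longrightarrow> (\<lambda>n. c n * z ^ n) sums g z" and \<rho>: "0 < \<rho>" "\<rho> < 1"
  shows "(\<lambda>n. pi * ((cmod (c n))\<^sup>2 * \<rho> ^ (2 * n + 2) / (n + 1))) sums
    (LINT z:ball 0 \<rho>|lborel. (cmod (g z))\<^sup>2)"
proof -
  let ?p = "\<lambda>N z. \<Sum>n<N. c n * z ^ n"
  let ?b = "\<lambda>z. indicator (ball (0::complex) \<rho>) z :: real"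
  define K where "K = (\<Sum>n. cmod (c n) * \<rho> ^ n)"
  have [measurable]: "ball (0::complex) \<rho> \<in> sets borel" by simp
  have summ: "summable (\<lambda>n. cmod (c n) * \<rho> ^ n)"
    using powser_abs_summable[OF sums, of "of_real \<rho>"] \<rho> by (simp add: norm_mult norm_power)
  have bound: "cmod (?p N z) \<le> K" if "cmod z < \<rho>" for N z
  proof -
    have "cmod (?p N z) \<le> (\<Sum>n<N. cmod (c n) * \<rho> ^ n)"
      using that by (intro sum_norm_le) (auto simp: norm_mult norm_power intro!: mult_left_mono power_mono)
    also have "\<dots> \<le> K" unfolding K_def using summ \<rho> by (intro sum_le_suminf) auto
    finally show ?thesis .
  qed
  have lim: "(\<lambda>N. ?b z *\<^sub>R (cmod (?p N z))\<^sup>2) \<longlonglongrightarrow> ?b z *\<^sub>R (cmod (g z))\<^sup>2" for z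
  proof (cases "cmod z < \<rho>")
    case True
    then have "(\<lambda>N. ?p N z) \<longlonglongrightarrow> g z" using sums \<rho> by (simp add: sums_def)
    then show ?thesis by (intro tendsto_intros)
  qed simp
  have [measurable]: "?p N \<in> borel_measurable borel" for N by measurable
  have "(\<lambda>N. LINT z|lborel. ?b z *\<^sub>R (cmod (?p N z))\<^sup>2) \<longlonglongrightarrow> (LINT z|lborel. ?b z *\<^sub>R (cmod (g z))\<^sup>2)"
  proof (rule integral_dominated_convergence[where w = "\<lambda>z. K\<^sup>2 * ?b z"])
    show "(\<lambda>z. ?b z *\<^sub>R (cmod (?p N z))\<^sup>2) \<in> borel_measurable lborel" for N by measurable
    \<comment> \<open>Nothing is known about \<open>g\<close> off the unit disk; its truncation is
      measurable as a pointwise limit.\<close>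
    then show "(\<lambda>z. ?b z *\<^sub>R (cmod (g z))\<^sup>2) \<in> borel_measurable lborel"
      by (rule borel_measurable_LIMSEQ_real[OF lim])
    show "integrable lborel (\<lambda>z. K\<^sup>2 * ?b z)"
      by (intro integrable_mult_right integrable_real_indicator emeasure_lborel_ball_finite) simp
    show "AE z in lborel. (\<lambda>N. ?b z *\<^sub>R (cmod (?p N z))\<^sup>2) \<longlonglongrightarrow> ?b z *\<^sub>R (cmod (g z))\<^sup>2"
      using lim by simp
    show "AE z in lborel. norm (?b z *\<^sub>R (cmod (?p N z))\<^sup>2) \<le> K\<^sup>2 * ?b z" for N
      using bound by (intro AE_I2) (auto simp: indicator_def intro!: power_mono)
  qed
  then show ?thesis
    using integral_ball_polynomial[OF \<rho>(1), of c]
    by (simp add: sums_def set_lebesgue_integral_def sum_distrib_left)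
qed

section \<open>Coefficient inequalities\<close>

lemma bounded_series_sums: "bounded_series f a \<Longrightarrow> cmod z < 1 \<Longrightarrow> (\<lambda>n. a n * z ^ n) sums f z"
  by (simp add: bounded_series_def)

lemma bounded_series_le: "bounded_series f a \<Longrightarrow> cmod z < 1 \<Longrightarrow> cmod (f z) \<le> 1"
  by (simp add: bounded_series_def)

lemma bounded_series_holomorphic: "bounded_series f a \<Longrightarrow> f holomorphic_on ball 0 1"
  by (simp add: bounded_series_def analytic_imp_holomorphic)

section \<open>Multiplication by a bounded function as a contraction\<close>

text \<open>Coefficients of the product of two power series; as a map of \<open>u\<close>, the lower
  triangular Toeplitz matrix built from \<open>a\<close>.\<close>

definition convolution :: "(nat \<Rightarrow> complex) \<Rightarrow> (nat \<Rightarrow> complex) \<Rightarrow> nat \<Rightarrow> complex" where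
  "convolution u a l = (\<Sum>i\<le>l. u i * a (l - i))"

text \<open>Since |p f| \<le> |p| on the disk, the area norms compare, and Parseval turns both into
  coefficient sums. The left sum may be cut off at \<open>N\<close> because its terms are
  nonnegative.\<close>

lemma weighted_multiplier_bound:
  assumes f: "bounded_series f a" and u: "\<And>j. j > K \<Longrightarrow> u j = 0" and \<rho>: "0 < \<rho>" "\<rho> < 1"
  shows "(\<Sum>l\<le>N. (cmod (convolution u a l))\<^sup>2 * \<rho> ^ (2 * l + 2) / (l + 1))
    \<le> (\<Sum>j\<le>K. (cmod (u j))\<^sup>2 * \<rho> ^ (2 * j + 2) / (j + 1))"
proof -
  define p where "p = (\<lambda>z. \<Sum>j\<le>K. u j * z ^ j)"
  have p: "(\<lambda>j. u j * z ^ j) sums p z" for z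
    unfolding p_def using u by (intro sums_finite) (auto simp: not_le)
  have pf: "(\<lambda>l. convolution u a l * z ^ l) sums (p z * f z)" if z: "cmod z < 1" for z
  proof -
    have "(\<lambda>l. \<Sum>i\<le>l. (u i * z ^ i) * (a (l - i) * z ^ (l - i)))
        sums ((\<Sum>j. u j * z ^ j) * (\<Sum>n. a n * z ^ n))"
      using powser_abs_summable[OF p z] powser_abs_summable[OF bounded_series_sums[OF f] z]
      by (intro Cauchy_product_sums) auto
    moreover have "(\<Sum>i\<le>l. (u i * z ^ i) * (a (l - i) * z ^ (l - i))) = convolution u a l * z ^ l" for l
      unfolding convolution_def sum_distrib_right
      by (intro sum.cong refl) (simp add: power_add[symmetric] mult_ac)
    ultimately show ?thesis
      using sums_unique[OF p[of z]] sums_unique[OF bounded_series_sums[OF f z]] by simp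
  qed
  have contf: "continuous_on (cball 0 \<rho>) f"
    using holomorphic_on_imp_continuous_on[OF bounded_series_holomorphic[OF f]] \<rho>
    by (rule_tac continuous_on_subset) auto
  have contp: "continuous_on (cball 0 \<rho>) p"
    unfolding p_def by (intro continuous_intros)
  have le: "(LINT z:ball 0 \<rho>|lborel. (cmod (p z * f z))\<^sup>2) \<le> (LINT z:ball 0 \<rho>|lborel. (cmod (p z))\<^sup>2)"
  proof (rule set_integral_mono)
    show "set_integrable lborel (ball 0 \<rho>) (\<lambda>z. (cmod (p z * f z))\<^sup>2)"
      "set_integrable lborel (ball 0 \<rho>) (\<lambda>z. (cmod (p z))\<^sup>2)"
      by (intro integrable_on_ball continuous_intros contf contp)+
    show "(cmod (p z * f z))\<^sup>2 \<le> (cmod (p z))\<^sup>2" if "z \<in> ball 0 \<rho>" for z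
      using bounded_series_le[OF f, of z] that \<rho>
      by (intro power_mono) (auto simp: norm_mult intro: mult_left_le)
  qed
  have "pi * (\<Sum>l\<le>N. (cmod (convolution u a l))\<^sup>2 * \<rho> ^ (2 * l + 2) / (l + 1))
      = (\<Sum>l\<le>N. pi * ((cmod (convolution u a l))\<^sup>2 * \<rho> ^ (2 * l + 2) / (l + 1)))"
    by (simp add: sum_distrib_left)
  also have "\<dots> \<le> (\<Sum>l. pi * ((cmod (convolution u a l))\<^sup>2 * \<rho> ^ (2 * l + 2) / (l + 1)))"
    using parseval_ball[OF pf \<rho>] \<rho> by (intro sum_le_suminf) (auto simp: sums_iff)
  also have "\<dots> = (LINT z:ball 0 \<rho>|lborel. (cmod (p z * f z))\<^sup>2)"
    using parseval_ball[OF pf \<rho>] by (simp add: sums_iff)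
  also note le
  also have "(LINT z:ball 0 \<rho>|lborel. (cmod (p z))\<^sup>2)
      = pi * (\<Sum>n<Suc K. (cmod (u n))\<^sup>2 * \<rho> ^ (2 * n + 2) / (n + 1))"
    unfolding p_def lessThan_Suc_atMost[symmetric] by (rule integral_ball_polynomial[OF \<rho>(1)])
  finally show ?thesis by (simp add: lessThan_Suc_atMost)
qed

lemma multiplier_bound_area:
  assumes f: "bounded_series f a" and u: "\<And>j. j > K \<Longrightarrow> u j = 0"
  shows "(\<Sum>l\<le>N. (cmod (convolution u a l))\<^sup>2 / (l + 1)) \<le> (\<Sum>j\<le>K. (cmod (u j))\<^sup>2 / (j + 1))"
proof (rule tendsto_le)
  show "((\<lambda>\<rho>. \<Sum>l\<le>N. (cmod (convolution u a l))\<^sup>2 * \<rho> ^ (2 * l + 2) / (l + 1))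
      \<longlongrightarrow> (\<Sum>l\<le>N. (cmod (convolution u a l))\<^sup>2 / (l + 1))) (at_left (1::real))"
    "((\<lambda>\<rho>. \<Sum>j\<le>K. (cmod (u j))\<^sup>2 * \<rho> ^ (2 * j + 2) / (j + 1))
      \<longlongrightarrow> (\<Sum>j\<le>K. (cmod (u j))\<^sup>2 / (j + 1))) (at_left (1::real))"
    by (rule tendsto_eq_intros refl | simp)+
  show "\<forall>\<^sub>F \<rho> in at_left (1::real). (\<Sum>l\<le>N. (cmod (convolution u a l))\<^sup>2 * \<rho> ^ (2 * l + 2) / (l + 1))
      \<le> (\<Sum>j\<le>K. (cmod (u j))\<^sup>2 * \<rho> ^ (2 * j + 2) / (j + 1))"
    using eventually_at_left_real[of 0 1, simplified]
    by eventually_elim (rule weighted_multiplier_bound[OF f u], auto)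
qed simp

text \<open>The weights \<open>1 / (l + 1)\<close> of the area norm become uniform when the multiplied polynomial is
  shifted by a high power \<open>z\<^sup>M\<close>: this replaces Hardy space norms by area integrals.\<close>

lemma multiplier_bound:
  assumes f: "bounded_series f a" and u: "\<And>j. j > K \<Longrightarrow> u j = 0"
  shows "(\<Sum>l\<le>N. (cmod (convolution u a l))\<^sup>2) \<le> (\<Sum>j\<le>K. (cmod (u j))\<^sup>2)"
proof (rule LIMSEQ_le)
  have lim: "(\<lambda>M. \<Sum>l\<le>L. (cmod (w l))\<^sup>2 * (M / real (l + M + 1))) \<longlonglongrightarrow> (\<Sum>l\<le>L. (cmod (w l))\<^sup>2)"
    for w :: "nat \<Rightarrow> complex" and L
  proof -
    have "(\<lambda>M. real M / real (l + M + 1)) \<longlonglongrightarrow> 1" for l by real_asymp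
    then have "(\<lambda>M. \<Sum>l\<le>L. (cmod (w l))\<^sup>2 * (M / real (l + M + 1))) \<longlonglongrightarrow> (\<Sum>l\<le>L. (cmod (w l))\<^sup>2 * 1)"
      by (intro tendsto_intros)
    then show ?thesis by simp
  qed
  show "(\<lambda>M. \<Sum>l\<le>N. (cmod (convolution u a l))\<^sup>2 * (M / real (l + M + 1)))
      \<longlonglongrightarrow> (\<Sum>l\<le>N. (cmod (convolution u a l))\<^sup>2)"
    "(\<lambda>M. \<Sum>l\<le>K. (cmod (u l))\<^sup>2 * (M / real (l + M + 1))) \<longlonglongrightarrow> (\<Sum>l\<le>K. (cmod (u l))\<^sup>2)"
    by (rule lim)+
  have "(\<Sum>l\<le>N. (cmod (convolution u a l))\<^sup>2 * (M / real (l + M + 1)))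
      \<le> (\<Sum>l\<le>K. (cmod (u l))\<^sup>2 * (M / real (l + M + 1)))" for M
  proof -
    define v where "v j = (if j < M then 0 else u (j - M))" for j
    have v: "v j = 0" if "j > K + M" for j using that u by (auto simp: v_def)
    have split: "(\<Sum>l\<le>L + M. h l) = (\<Sum>l<M. h l) + (\<Sum>l\<le>L. h (l + M))" for h :: "nat \<Rightarrow> 'b::comm_monoid_add" and L
    proof -
      have "{..L + M} = {..<M} \<union> {M..L + M}" by auto
      then show ?thesis
        using sum.shift_bounds_cl_nat_ivl[of h 0 M L]
        by (simp add: sum.union_disjoint ivl_disj_int atLeast0AtMost)
    qed
    have conv: "convolution v a (l + M) = convolution u a l" for l
      unfolding convolution_def split by (simp add: v_def)
    have "(\<Sum>l\<le>N. (cmod (convolution u a l))\<^sup>2 / real (l + M + 1))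
        \<le> (\<Sum>l\<le>N + M. (cmod (convolution v a l))\<^sup>2 / real (l + 1))"
      unfolding split by (auto simp: conv intro!: sum_nonneg)
    also have "\<dots> \<le> (\<Sum>j\<le>K + M. (cmod (v j))\<^sup>2 / real (j + 1))"
      by (rule multiplier_bound_area[OF f v])
    also have "\<dots> = (\<Sum>j\<le>K. (cmod (u j))\<^sup>2 / real (j + M + 1))"
      unfolding split by (simp add: v_def)
    finally have "M * (\<Sum>l\<le>N. (cmod (convolution u a l))\<^sup>2 / real (l + M + 1))
        \<le> M * (\<Sum>j\<le>K. (cmod (u j))\<^sup>2 / real (j + M + 1))"
      by (rule mult_left_mono) simp
    then show ?thesis by (simp add: sum_distrib_left mult_ac)
  qed
  then show "\<exists>n0. \<forall>M\<ge>n0. (\<Sum>l\<le>N. (cmod (convolution u a l))\<^sup>2 * (M / real (l + M + 1)))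
      \<le> (\<Sum>l\<le>K. (cmod (u l))\<^sup>2 * (M / real (l + M + 1)))" by blast
qed

text \<open>The contraction property paired with a test vector. The arithmetic mean on the right is
  as good as Cauchy-Schwarz in the intended use, where \<open>u\<close> and \<open>v\<close> have
  equal norms.\<close>

lemma multiplier_bilinear_bound:
  assumes f: "bounded_series f a" and u: "\<And>j. j > N \<Longrightarrow> u j = 0"
  shows "Re (\<Sum>l\<le>N. convolution u a l * cnj (v l))
    \<le> ((\<Sum>j\<le>N. (cmod (u j))\<^sup>2) + (\<Sum>j\<le>N. (cmod (v j))\<^sup>2)) / 2"
proof -
  have *: "Re (w * cnj y) \<le> ((cmod w)\<^sup>2 + (cmod y)\<^sup>2) / 2" for w y
  proof -
    have "Re (w * cnj y) \<le> cmod w * cmod y" by (metis complex_Re_le_cmod complex_mod_cnj norm_mult)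
    also have "\<dots> \<le> ((cmod w)\<^sup>2 + (cmod y)\<^sup>2) / 2"
      using sum_squares_bound[of "cmod w" "cmod y"] by simp
    finally show ?thesis .
  qed
  have "Re (\<Sum>l\<le>N. convolution u a l * cnj (v l)) = (\<Sum>l\<le>N. Re (convolution u a l * cnj (v l)))"
    by (rule Re_sum)
  also have "\<dots> \<le> (\<Sum>l\<le>N. ((cmod (convolution u a l))\<^sup>2 + (cmod (v l))\<^sup>2) / 2)"
    by (intro sum_mono *)
  also have "\<dots> = ((\<Sum>l\<le>N. (cmod (convolution u a l))\<^sup>2) + (\<Sum>l\<le>N. (cmod (v l))\<^sup>2)) / 2"
    by (simp add: sum.distrib flip: sum_divide_distrib)
  also have "\<dots> \<le> ((\<Sum>j\<le>N. (cmod (u j))\<^sup>2) + (\<Sum>j\<le>N. (cmod (v j))\<^sup>2)) / 2"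
    using multiplier_bound[OF f u] by simp
  finally show ?thesis .
qed

section \<open>Toeplitz test vectors and Carlson's inequalities\<close>

lemma sum_atMost_restrict_le:
  fixes h :: "nat \<Rightarrow> 'b::comm_monoid_add"
  assumes "m \<le> N"
  shows "(\<Sum>k\<le>N. if k \<le> m then h k else 0) = (\<Sum>k\<le>m. h k)"
proof -
  have "{..N} \<inter> {k. k \<le> m} = {..m}" using assms by auto
  then show ?thesis by (simp add: sum.If_cases)
qed

lemma sum_atMost_reflect:
  fixes h :: "nat \<Rightarrow> 'b::comm_monoid_add"
  shows "(\<Sum>k\<le>N. h (N - k)) = (\<Sum>k\<le>N. h k)"
  using sum.atLeastAtMost_rev[of h 0 N] by (simp add: atLeast0AtMost)

text \<open>The truncated Toeplitz matrix of \<open>f\<close> is tested on \<open>u = 1 + e \<Sum> t\<^sub>k cnj a\<^sub>k z\<^bsup>N - k\<^esup>\<close> and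
  \<open>v = \<Sum> t\<^sub>k a\<^sub>k z\<^sup>k + e z\<^sup>N\<close>, where \<open>k\<close> runs up to \<open>m\<close>. The case \<open>2 m = N\<close> produces one overlap,
  which the free weight \<open>t\<^sub>m\<close> is there to absorb.\<close>

lemma weighted_coefficient_inequality:
  fixes t :: "nat \<Rightarrow> real"
  assumes f: "bounded_series f a" and m: "m < N" "2 * m \<le> N"
  shows "2 * (\<Sum>k\<le>m. t k * (cmod (a k))\<^sup>2) + cmod (a N)
      - (if 2 * m = N then (t m)\<^sup>2 * (cmod (a m))\<^sup>2 * cmod (a 0) else 0)
    \<le> 1 + (\<Sum>k\<le>m. (t k)\<^sup>2 * (cmod (a k))\<^sup>2)"
proof -
  \<comment> \<open>The phase of \<open>a N\<close>, with default 1 at \<open>a N = 0\<close>, so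
    that \<open>e\<close> always has modulus 1.\<close>
  define e where "e = (if a N = 0 then 1 else a N / of_real (cmod (a N)))"
  have e1: "cmod e = 1" by (simp add: e_def norm_divide)
  have e2: "cnj e * a N = of_real (cmod (a N))"
  proof (cases "a N = 0")
    case False
    then have "cnj e * a N = (a N * cnj (a N)) / of_real (cmod (a N))" by (simp add: e_def)
    also have "\<dots> = of_real (cmod (a N) * cmod (a N) / cmod (a N))"
      unfolding complex_norm_square[symmetric] by (simp add: power2_eq_square)
    finally show ?thesis using False by simp
  qed simp
  note e = e1 e2
  have ee: "e * cnj e = 1" unfolding complex_norm_square[symmetric] by (simp add: e1)
  define u where "u j = (if j = 0 then 1 else 0)
    + (if N - j \<le> m \<and> j \<le> N then e * of_real (t (N - j)) * cnj (a (N - j)) else 0)" for j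
  define v where "v l = (if l \<le> m then of_real (t l) * a l else 0) + (if l = N then e else 0)" for l
  define S where "S = (\<Sum>k\<le>m. t k * (cmod (a k))\<^sup>2)"
  define T where "T = (\<Sum>k\<le>m. (t k)\<^sup>2 * (cmod (a k))\<^sup>2)"
  \<comment> \<open>The block of \<open>u\<close> occupies the indices N - m to N. It reaches down
    to \<open>m\<close> only if 2 m = N, and then its lowest entry meets \<open>a 0\<close> in
    coefficient \<open>m\<close> of the product.\<close>
  define \<delta> where "\<delta> = (if 2 * m = N then e * of_real (t m) * cnj (a m) * a 0 else 0)"
  have u0: "u j = 0" if "j > N" for j using that m by (auto simp: u_def)
  have normu: "(\<Sum>j\<le>N. (cmod (u j))\<^sup>2) = 1 + T"
  proof -
    let ?h = "\<lambda>k. if k \<le> m then (t k)\<^sup>2 * (cmod (a k))\<^sup>2 else 0"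
    have "(\<Sum>j\<le>N. (cmod (u j))\<^sup>2) = (\<Sum>j\<le>N. (if j = 0 then 1 else 0) + ?h (N - j))"
      using m e by (intro sum.cong refl) (auto simp: u_def norm_mult power_mult_distrib)
    also have "\<dots> = 1 + (\<Sum>j\<le>N. ?h (N - j))" by (simp add: sum.distrib)
    also have "(\<Sum>j\<le>N. ?h (N - j)) = T"
      unfolding T_def by (rule trans[OF sum_atMost_reflect[of ?h] sum_atMost_restrict_le]) (use m in simp)
    finally show ?thesis .
  qed
  have normv: "(\<Sum>l\<le>N. (cmod (v l))\<^sup>2) = 1 + T"
  proof -
    have "(\<Sum>l\<le>N. (cmod (v l))\<^sup>2)
        = (\<Sum>l\<le>N. (if l \<le> m then (t l)\<^sup>2 * (cmod (a l))\<^sup>2 else 0) + (if l = N then 1 else 0))"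
      using m e by (intro sum.cong refl) (auto simp: v_def norm_mult power_mult_distrib)
    also have "\<dots> = T + 1"
      using m by (simp add: sum.distrib sum_atMost_restrict_le T_def)
    finally show ?thesis by simp
  qed
  have conv: "convolution u a l = a l + (if l = m then \<delta> else 0)" if "l \<le> m" for l
  proof -
    have "convolution u a l = (\<Sum>i\<le>l. (if i = 0 then a l else 0) + (if i = m then \<delta> else 0))"
      unfolding convolution_def using m that
      by (intro sum.cong refl) (auto simp: u_def \<delta>_def)
    then show ?thesis using that by (simp add: sum.distrib)
  qed
  \<comment> \<open>At index \<open>N\<close> every block entry meets the coefficient whose
    conjugate it contains, which yields the sum of t_k |a_k|^2.\<close>
  have convN: "convolution u a N = a N + e * of_real S"
  proof -
    let ?h = "\<lambda>k. if k \<le> m then e * of_real (t k * (cmod (a k))\<^sup>2) else 0"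
    have "convolution u a N = (\<Sum>i\<le>N. (if i = 0 then a N else 0) + ?h (N - i))"
      unfolding convolution_def using m unfolding of_real_mult complex_norm_square
      by (intro sum.cong refl) (auto simp: u_def)
    also have "\<dots> = a N + (\<Sum>i\<le>N. ?h (N - i))" by (simp add: sum.distrib)
    also have "(\<Sum>i\<le>N. ?h (N - i)) = (\<Sum>k\<le>m. e * of_real (t k * (cmod (a k))\<^sup>2))"
      by (rule trans[OF sum_atMost_reflect[of ?h] sum_atMost_restrict_le]) (use m in simp)
    also have "\<dots> = e * of_real S" by (simp only: S_def of_real_sum sum_distrib_left)
    finally show ?thesis .
  qed
  have "(\<Sum>l\<le>N. convolution u a l * cnj (v l))
      = (\<Sum>l\<le>N. (if l \<le> m then convolution u a l * of_real (t l) * cnj (a l) else 0)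
          + (if l = N then convolution u a N * cnj e else 0))"
    using m by (intro sum.cong refl) (auto simp: v_def)
  also have "\<dots> = (\<Sum>l\<le>m. convolution u a l * of_real (t l) * cnj (a l)) + convolution u a N * cnj e"
    using m by (simp add: sum.distrib sum_atMost_restrict_le)
  also have "(\<Sum>l\<le>m. convolution u a l * of_real (t l) * cnj (a l))
      = (\<Sum>l\<le>m. of_real (t l * (cmod (a l))\<^sup>2) + (if l = m then \<delta> * of_real (t m) * cnj (a m) else 0))"
    unfolding of_real_mult complex_norm_square
    by (intro sum.cong refl) (auto simp: conv algebra_simps)
  also have "\<dots> = of_real S + \<delta> * of_real (t m) * cnj (a m)"
    by (simp add: sum.distrib S_def)
  also have "convolution u a N * cnj e = of_real (cmod (a N) + S)"
  proof -
    have "convolution u a N * cnj e = cnj e * a N + (e * cnj e) * of_real S"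
      unfolding convN by (simp add: algebra_simps)
    then show ?thesis unfolding ee e2 by simp
  qed
  finally have sum: "Re (\<Sum>l\<le>N. convolution u a l * cnj (v l))
      = 2 * S + cmod (a N) + Re (\<delta> * of_real (t m) * cnj (a m))" by simp
  have "\<bar>Re (\<delta> * of_real (t m) * cnj (a m))\<bar> \<le> cmod (\<delta> * of_real (t m) * cnj (a m))"
    by (rule abs_Re_le_cmod)
  also have "\<dots> = (if 2 * m = N then (t m)\<^sup>2 * (cmod (a m))\<^sup>2 * cmod (a 0) else 0)"
    using e by (simp add: \<delta>_def norm_mult power2_eq_square)
  finally have "- Re (\<delta> * of_real (t m) * cnj (a m))
      \<le> (if 2 * m = N then (t m)\<^sup>2 * (cmod (a m))\<^sup>2 * cmod (a 0) else 0)" by linarith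
  moreover have "2 * S + cmod (a N) + Re (\<delta> * of_real (t m) * cnj (a m)) \<le> 1 + T"
    using multiplier_bilinear_bound[where u = u and v = v and N = N, OF f u0]
    unfolding sum normu normv by simp
  ultimately show ?thesis unfolding S_def[symmetric] T_def[symmetric] by linarith
qed

lemma coefficient_le:
  assumes "bounded_series f a" and "n \<ge> 1"
  shows "cmod (a n) \<le> 1 - (cmod (a 0))\<^sup>2"
  using weighted_coefficient_inequality[OF assms(1), of 0 n "\<lambda>_. 1"] assms(2) by auto

lemma carlson_odd:
  assumes "bounded_series f a"
  shows "cmod (a (2 * n + 1)) \<le> 1 - (\<Sum>k\<le>n. (cmod (a k))\<^sup>2)"
  using weighted_coefficient_inequality[OF assms, of n "2 * n + 1" "\<lambda>_. 1"] by simp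

lemma carlson_even:
  assumes "bounded_series f a" and n: "n \<ge> 1"
  shows "cmod (a (2 * n)) \<le> 1 - (\<Sum>k<n. (cmod (a k))\<^sup>2) - (cmod (a n))\<^sup>2 / (1 + cmod (a 0))"
proof -
  \<comment> \<open>Minimises s^2 (1 + A) - 2 s, the coefficient that |a_n|^2 receives when the
    weight s = t_n is left free; the minimum is -1 / (1 + A).\<close>
  define s where "s = 1 / (1 + cmod (a 0))"
  have s: "s * (1 + cmod (a 0)) = 1" by (simp add: s_def add_nonneg_eq_0_iff)
  define t where "t k = (if k = n then s else 1)" for k
  have split: "(\<Sum>k\<le>n. h k) = (\<Sum>k<n. h k) + h n" for h :: "nat \<Rightarrow> real"
    by (simp add: lessThan_Suc_atMost[symmetric])
  have "2 * ((\<Sum>k<n. (cmod (a k))\<^sup>2) + s * (cmod (a n))\<^sup>2) + cmod (a (2 * n))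
      - s\<^sup>2 * (cmod (a n))\<^sup>2 * cmod (a 0) \<le> 1 + ((\<Sum>k<n. (cmod (a k))\<^sup>2) + s\<^sup>2 * (cmod (a n))\<^sup>2)"
    using weighted_coefficient_inequality[OF assms(1), of n "2 * n" t] n
    by (simp add: split t_def)
  moreover have "s\<^sup>2 * (cmod (a n))\<^sup>2 * cmod (a 0) + s\<^sup>2 * (cmod (a n))\<^sup>2 = s * (cmod (a n))\<^sup>2"
  proof -
    have "s\<^sup>2 * (cmod (a n))\<^sup>2 * cmod (a 0) + s\<^sup>2 * (cmod (a n))\<^sup>2
        = s * (s * (1 + cmod (a 0))) * (cmod (a n))\<^sup>2" by (simp add: algebra_simps power2_eq_square)
    then show ?thesis by (simp add: s)
  qed
  ultimately show ?thesis by (simp add: s_def)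
qed

section \<open>Summation of Carlson's inequalities\<close>

text \<open>For k \<ge> 1, |a_k|^2 lowers Carlson's bound for a_(2k) by |a_k|^2 / (1 + A) and that
  for every later coefficient by |a_k|^2. Weighted with powers of r this totals r^(2k) (1/(1 + A) +
  r/(1 - r)) |a_k|^2, the matching term of the second series. The last summand on the right is the
  share of this compensation that belongs to indices from 2N + 2 on.\<close>

lemma refined_bohr_partial_sum:
  fixes r :: real
  assumes f: "bounded_series f a" and r: "0 \<le> r" "r < 1"
  shows "(\<Sum>n<2 * N. cmod (a (n + 2)) * r ^ (n + 2))
      + (1 / (1 + cmod (a 0)) + r / (1 - r)) * (\<Sum>n<N. (cmod (a (n + 1)))\<^sup>2 * r ^ (2 * (n + 1)))
    \<le> (1 - (cmod (a 0))\<^sup>2) * (r\<^sup>2 - r ^ (2 * N + 2)) / (1 - r)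
      + (\<Sum>n<N. (cmod (a (n + 1)))\<^sup>2) * r ^ (2 * N + 2) / (1 - r)"
proof (induction N)
  case 0
  then show ?case by (simp add: power2_eq_square)
next
  case (Suc N)
  define A where "A = cmod (a 0)"
  define P where "P = r ^ (2 * N + 2)"
  define s where "s = (\<Sum>n<N. (cmod (a (n + 1)))\<^sup>2)"
  define y where "y = (cmod (a (N + 1)))\<^sup>2"
  have P: "P \<ge> 0" using r by (simp add: P_def)
  have s: "(\<Sum>k<Suc N. (cmod (a k))\<^sup>2) = A\<^sup>2 + s"
    unfolding s_def A_def by (subst sum.lessThan_Suc_shift) simp
  have even: "cmod (a (2 * N + 2)) \<le> 1 - A\<^sup>2 - s - y / (1 + A)"
    using carlson_even[OF f, of "Suc N"] unfolding s by (simp add: A_def y_def)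
  have odd: "cmod (a (2 * N + 3)) \<le> 1 - A\<^sup>2 - s - y"
    using carlson_odd[OF f, of "Suc N"] s
    unfolding lessThan_Suc_atMost[symmetric] by (simp add: y_def numeral_3_eq_3)
  have r1: "1 - r \<noteq> 0" using r by simp
  have pw: "r ^ (2 * N + 3) = P * r" "r ^ (2 * Suc N + 2) = P * r\<^sup>2" "r ^ (2 * (N + 1)) = P"
    by (simp_all add: P_def power2_eq_square numeral_3_eq_3 mult_ac)
  define L where "L = (\<Sum>n<2 * N. cmod (a (n + 2)) * r ^ (n + 2))"
  define K where "K = 1 / (1 + A) + r / (1 - r)"
  define Y where "Y = (\<Sum>n<N. (cmod (a (n + 1)))\<^sup>2 * r ^ (2 * (n + 1)))"
  have IH: "L + K * Y \<le> (1 - A\<^sup>2) * (r\<^sup>2 - P) / (1 - r) + s * P / (1 - r)"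
    using Suc.IH by (simp only: L_def K_def Y_def A_def P_def s_def)
  have "cmod (a (2 * N + 2)) * P + cmod (a (2 * N + 3)) * (P * r) + K * (y * P)
      \<le> (1 - A\<^sup>2 - s - y / (1 + A)) * P + (1 - A\<^sup>2 - s - y) * (P * r) + K * (y * P)"
    using mult_right_mono[OF even P] mult_right_mono[OF odd, of "P * r"] P r by simp
  also have "\<dots> = P * (1 + r) * (1 - A\<^sup>2 - s) + y * P * (r / (1 - r) - r)"
    by (simp add: K_def algebra_simps)
  also have "r / (1 - r) - r = r\<^sup>2 / (1 - r)"
    using r1 by (simp add: field_simps power2_eq_square)
  also have "P * (1 + r) * (1 - A\<^sup>2 - s) + y * P * (r\<^sup>2 / (1 - r))
      = (1 - A\<^sup>2) * (P - P * r\<^sup>2) / (1 - r) + (s + y) * (P * r\<^sup>2) / (1 - r) - s * P / (1 - r)"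
    using r1 by (simp add: divide_simps) (simp add: algebra_simps power2_eq_square)
  finally have step: "cmod (a (2 * N + 2)) * P + cmod (a (2 * N + 3)) * (P * r) + K * (y * P)
      \<le> (1 - A\<^sup>2) * (P - P * r\<^sup>2) / (1 - r) + (s + y) * (P * r\<^sup>2) / (1 - r) - s * P / (1 - r)" .
  have e1: "(\<Sum>n<2 * Suc N. cmod (a (n + 2)) * r ^ (n + 2))
      = L + cmod (a (2 * N + 2)) * P + cmod (a (2 * N + 3)) * (P * r)"
    unfolding L_def pw(1)[symmetric] P_def by (simp add: numeral_3_eq_3)
  have e2: "(\<Sum>n<Suc N. (cmod (a (n + 1)))\<^sup>2 * r ^ (2 * (n + 1))) = Y + y * P"
    unfolding Y_def y_def pw(3)[symmetric] by simp
  have e3: "(\<Sum>n<Suc N. (cmod (a (n + 1)))\<^sup>2) = s + y"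
    by (simp add: s_def y_def)
  have e4: "(1 - A\<^sup>2) * (r\<^sup>2 - P) / (1 - r) + (1 - A\<^sup>2) * (P - P * r\<^sup>2) / (1 - r)
      = (1 - A\<^sup>2) * (r\<^sup>2 - P * r\<^sup>2) / (1 - r)"
    by (simp add: add_divide_distrib[symmetric] distrib_left[symmetric])
  show ?case
    unfolding e1 e2 e3 pw A_def[symmetric] K_def[symmetric] distrib_left[of K Y]
    using add_mono[OF IH step] e4 by linarith
qed

lemma coefficient_summable:
  fixes r :: real
  assumes f: "bounded_series f a" and r: "0 \<le> r" "r < 1"
  shows "summable (\<lambda>n. cmod (a (n + k)) * r ^ (n + k))"
    and "summable (\<lambda>n. (cmod (a (n + 1)))\<^sup>2 * r ^ (2 * (n + 1)))"
proof -
  have *: "summable (\<lambda>n. cmod (a n) * r ^ n)"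
    using powser_abs_summable[OF bounded_series_sums[OF f], of "of_real r"] r
    by (simp add: norm_mult norm_power)
  then show s: "summable (\<lambda>n. cmod (a (n + k)) * r ^ (n + k))" for k
    by (rule summable_ignore_initial_segment)
  show "summable (\<lambda>n. (cmod (a (n + 1)))\<^sup>2 * r ^ (2 * (n + 1)))"
  proof (rule summable_comparison_test'[OF s[of 1]])
    fix n :: nat
    have "cmod (a (n + 1)) \<le> 1" using coefficient_le[OF f, of "n + 1"] by (simp add: order_trans)
    moreover have "r ^ (n + 1) \<le> 1" using r by (intro power_le_one) auto
    ultimately have "cmod (a (n + 1)) * r ^ (n + 1) \<le> 1"
      using mult_mono[of "cmod (a (n + 1))" 1 "r ^ (n + 1)" 1] r by simp
    then have "(cmod (a (n + 1)) * r ^ (n + 1)) * (cmod (a (n + 1)) * r ^ (n + 1))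
        \<le> 1 * (cmod (a (n + 1)) * r ^ (n + 1))"
      using r by (intro mult_right_mono) auto
    moreover have "(cmod (a (n + 1)))\<^sup>2 * r ^ (2 * (n + 1))
        = (cmod (a (n + 1)) * r ^ (n + 1)) * (cmod (a (n + 1)) * r ^ (n + 1))"
      unfolding power_even_eq[of r "n + 1"] by (simp add: power2_eq_square mult_ac)
    ultimately have "(cmod (a (n + 1)))\<^sup>2 * r ^ (2 * (n + 1)) \<le> cmod (a (n + 1)) * r ^ (n + 1)"
      by linarith
    moreover have "(cmod (a (n + 1)))\<^sup>2 * r ^ (2 * (n + 1)) \<ge> 0" using r by simp
    ultimately show "norm ((cmod (a (n + 1)))\<^sup>2 * r ^ (2 * (n + 1))) \<le> cmod (a (n + 1)) * r ^ (n + 1)"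
      unfolding real_norm_def by linarith
  qed
qed

lemma refined_bohr_sum:
  fixes r :: real
  assumes f: "bounded_series f a" and r: "0 \<le> r" "r < 1"
  shows "(\<Sum>n. cmod (a (n + 2)) * r ^ (n + 2))
      + (1 / (1 + cmod (a 0)) + r / (1 - r)) * (\<Sum>n. (cmod (a (n + 1)))\<^sup>2 * r ^ (2 * (n + 1)))
    \<le> (1 - (cmod (a 0))\<^sup>2) * r\<^sup>2 / (1 - r)" (is "_ \<le> ?B")
proof (rule LIMSEQ_le_const2)
  let ?l = "\<lambda>N. (\<Sum>n<2 * N. cmod (a (n + 2)) * r ^ (n + 2))
      + (1 / (1 + cmod (a 0)) + r / (1 - r)) * (\<Sum>n<N. (cmod (a (n + 1)))\<^sup>2 * r ^ (2 * (n + 1)))"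
  have "strict_mono (\<lambda>N::nat. 2 * N)" by (simp add: strict_mono_def)
  from LIMSEQ_subseq_LIMSEQ[OF summable_LIMSEQ[OF coefficient_summable(1)[OF f r, of 2]] this]
  show "?l \<longlonglongrightarrow> (\<Sum>n. cmod (a (n + 2)) * r ^ (n + 2))
      + (1 / (1 + cmod (a 0)) + r / (1 - r)) * (\<Sum>n. (cmod (a (n + 1)))\<^sup>2 * r ^ (2 * (n + 1)))"
    using summable_LIMSEQ[OF coefficient_summable(2)[OF f r]]
    by (intro tendsto_intros) (simp_all add: o_def)
  have "?l N \<le> ?B" for N
  proof -
    \<comment> \<open>As |a_(2N+1)| is nonnegative, Carlson's inequality also bounds the sum of
      squares; the leftover of the partial sum then completes the geometric series exactly.\<close>
    have "(\<Sum>k\<le>N. (cmod (a k))\<^sup>2) = (cmod (a 0))\<^sup>2 + (\<Sum>n<N. (cmod (a (n + 1)))\<^sup>2)"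
      unfolding lessThan_Suc_atMost[symmetric] by (subst sum.lessThan_Suc_shift) simp
    then have "(\<Sum>n<N. (cmod (a (n + 1)))\<^sup>2) \<le> 1 - (cmod (a 0))\<^sup>2"
      using carlson_odd[OF f, of N] norm_ge_zero[of "a (2 * N + 1)"] by linarith
    then have "(\<Sum>n<N. (cmod (a (n + 1)))\<^sup>2) * r ^ (2 * N + 2) / (1 - r)
        \<le> (1 - (cmod (a 0))\<^sup>2) * r ^ (2 * N + 2) / (1 - r)"
      using r by (intro divide_right_mono mult_right_mono) auto
    then have "?l N \<le> (1 - (cmod (a 0))\<^sup>2) * (r\<^sup>2 - r ^ (2 * N + 2)) / (1 - r)
        + (1 - (cmod (a 0))\<^sup>2) * r ^ (2 * N + 2) / (1 - r)"
      using refined_bohr_partial_sum[OF f r, of N] by linarith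
    also have "\<dots> = ?B"
      by (simp only: add_divide_distrib[symmetric] distrib_left[symmetric]) simp
    finally show ?thesis .
  qed
  then show "\<exists>N0. \<forall>N\<ge>N0. ?l N \<le> ?B" by blast
qed

section \<open>Pointwise and area estimates\<close>

lemma bounded_series_0: "bounded_series f a \<Longrightarrow> f 0 = a 0"
  using bounded_series_sums[of f a 0] powser_sums_zero[of a] sums_unique2 by fastforce

lemma holomorphic_bounded_series:
  assumes "f holomorphic_on ball 0 1" and "\<And>z. cmod z < 1 \<Longrightarrow> cmod (f z) \<le> 1"
  shows "bounded_series f (\<lambda>n. (deriv ^^ n) f 0 / fact n)"
  using assms holomorphic_power_series[OF assms(1)]
  by (simp add: bounded_series_def analytic_on_open)

text \<open>By the maximum modulus principle. The Schwarz lemma is applied to a Moebius transform of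
  \<open>f\<close>, which requires values strictly inside the disk, so unimodular constants are set
  apart.\<close>

lemma bounded_series_cases:
  assumes f: "bounded_series f a"
  obtains (const) c where "cmod c = 1" "\<And>z. cmod z < 1 \<Longrightarrow> f z = c"
  | (strict) "\<And>z. cmod z < 1 \<Longrightarrow> cmod (f z) < 1"
proof (cases "\<exists>w. cmod w < 1 \<and> cmod (f w) = 1")
  case True
  then obtain w where w: "cmod w < 1" "cmod (f w) = 1" by blast
  have "f constant_on ball 0 1"
    by (rule maximum_modulus_principle[OF bounded_series_holomorphic[OF f], of "ball 0 1" w])
       (use w bounded_series_le[OF f] in auto)
  then obtain c where c: "\<And>z. cmod z < 1 \<Longrightarrow> f z = c" unfolding constant_on_def by auto
  then show ?thesis using w const by auto
next
  case False
  then show ?thesis using bounded_series_le[OF f] strict by force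
qed

text \<open>The hypothesis is a squared Schwarz-Pick inequality with x = |f(z)|. Left minus right
  factors as ((1 + A r) x - (A + r)) ((1 - A r) x - (A - r)); an \<open>x\<close> above the root (A
  + r)/(1 + A r) would exceed the other root too and make the product positive.\<close>

lemma quadratic_growth_bound:
  fixes x A r :: real
  assumes A: "0 \<le> A" "A < 1" and r: "0 \<le> r" "r < 1"
    and le: "x\<^sup>2 + A\<^sup>2 - r\<^sup>2 - r\<^sup>2 * A\<^sup>2 * x\<^sup>2 \<le> 2 * (A * x) * (1 - r\<^sup>2)"
  shows "x \<le> (A + r) / (1 + A * r)"
proof (rule ccontr)
  have pos: "1 + A * r > 0" "1 - A * r > 0"
    using A r mult_strict_mono[of A 1 r 1] by (auto simp: add_pos_nonneg intro: order_le_less_trans[OF mult_left_le])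
  assume "\<not> x \<le> (A + r) / (1 + A * r)"
  then have gt: "(1 + A * r) * x > A + r" using pos by (simp add: field_simps)
  have prod: "((1 + A * r) * x - (A + r)) * ((1 - A * r) * x - (A - r))
      = x\<^sup>2 + A\<^sup>2 - r\<^sup>2 - r\<^sup>2 * A\<^sup>2 * x\<^sup>2 - 2 * (A * x) * (1 - r\<^sup>2)"
    by (simp add: algebra_simps power2_eq_square)
  have "\<not> (1 - A * r) * x > A - r"
  proof
    assume "(1 - A * r) * x > A - r"
    then have "((1 + A * r) * x - (A + r)) * ((1 - A * r) * x - (A - r)) > 0" using gt by simp
    then show False unfolding prod using le by simp
  qed
  then have "(1 + A * r) * ((1 - A * r) * x) \<le> (1 + A * r) * (A - r)"
    using pos by (intro mult_left_mono) auto
  moreover have "(1 - A * r) * (A + r) < (1 - A * r) * ((1 + A * r) * x)"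
    using pos gt by (intro mult_strict_left_mono) auto
  ultimately have "(1 - A * r) * (A + r) < (1 + A * r) * (A - r)"
    by (simp add: mult.left_commute mult.commute)
  then have "r < r * A\<^sup>2" by (simp add: algebra_simps power2_eq_square)
  moreover have "r * A\<^sup>2 \<le> r * 1" using A r by (intro mult_left_mono power_le_one) auto
  ultimately show False by simp
qed

lemma schwarz_pick_growth:
  assumes f: "bounded_series f a" and z: "cmod z < 1"
  shows "cmod (f z) \<le> (cmod (a 0) + cmod z) / (1 + cmod (a 0) * cmod z)"
  using f
proof (cases rule: bounded_series_cases)
  case (const c)
  then have "cmod (a 0) = 1" using bounded_series_0[OF f] by (metis norm_zero zero_less_one)
  then show ?thesis using const z by simp (smt (verit) divide_self_if norm_ge_zero)
next
  case strict
  define A where "A = cmod (a 0)"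
  have a0: "A < 1" using strict[of 0] bounded_series_0[OF f] by (simp add: A_def)
  define g where "g = (\<lambda>z. Moebius_function 0 (a 0) (f z))"
  have "g holomorphic_on ball 0 1"
    unfolding g_def
    by (rule holomorphic_on_compose_gen[OF bounded_series_holomorphic[OF f]
          Moebius_function_holomorphic, unfolded o_def]) (use a0 strict in \<open>auto simp: A_def\<close>)
  then have "cmod (g z) \<le> cmod z"
    by (rule Schwarz_Lemma(1))
       (use a0 strict z in \<open>auto simp: g_def A_def bounded_series_0[OF f] Moebius_function_eq_zero Moebius_function_norm_lt_1\<close>)
  then have le: "cmod (f z - a 0) \<le> cmod z * cmod (1 - cnj (a 0) * f z)"
  proof -
    have "cmod (cnj (a 0) * f z) < 1"
      using a0 strict[OF z] mult_strict_mono[of "cmod (a 0)" 1 "cmod (f z)" 1]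
      by (simp add: norm_mult A_def)
    then have "1 - cnj (a 0) * f z \<noteq> 0" by auto
    then show ?thesis using \<open>cmod (g z) \<le> cmod z\<close>
      by (simp add: g_def Moebius_function_simple norm_divide divide_le_eq)
  qed
  define x where "x = cmod (f z)"
  define c where "c = Re (cnj (a 0) * f z)"
  \<comment> \<open>The mixed term will carry the nonnegative factor 1 - |z|^2, so this worst case
    over the arguments may be inserted.\<close>
  have "c \<le> A * x" unfolding c_def A_def x_def
    by (metis complex_Re_le_cmod complex_mod_cnj norm_mult)
  have e1: "(cmod (f z - a 0))\<^sup>2 = x\<^sup>2 - 2 * c + A\<^sup>2"
    unfolding x_def A_def c_def cmod_power2 by (simp add: power2_eq_square algebra_simps)
  have e2: "(cmod (1 - cnj (a 0) * f z))\<^sup>2 = 1 - 2 * c + A\<^sup>2 * x\<^sup>2"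
    unfolding x_def A_def c_def cmod_power2 by (simp add: power2_eq_square algebra_simps)
  have "(cmod (f z - a 0))\<^sup>2 \<le> (cmod z * cmod (1 - cnj (a 0) * f z))\<^sup>2"
    using le by (intro power_mono) auto
  then have "x\<^sup>2 - 2 * c + A\<^sup>2 \<le> (cmod z)\<^sup>2 * (1 - 2 * c + A\<^sup>2 * x\<^sup>2)"
    by (simp only: power_mult_distrib e1 e2)
  then have "x\<^sup>2 + A\<^sup>2 - (cmod z)\<^sup>2 - (cmod z)\<^sup>2 * A\<^sup>2 * x\<^sup>2 \<le> 2 * c * (1 - (cmod z)\<^sup>2)"
    by (simp add: algebra_simps)
  also have "\<dots> \<le> 2 * (A * x) * (1 - (cmod z)\<^sup>2)"
    using \<open>c \<le> A * x\<close> z by (intro mult_right_mono) (auto simp: abs_square_le_1)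
  finally show ?thesis
    using a0 z quadratic_growth_bound[of A "cmod z" x] unfolding x_def A_def by simp
qed

text \<open>Composing with a disk automorphism turns the coefficient bound \<open>\<bar>a\<^sub>1\<bar> \<le> 1 - \<bar>a\<^sub>0\<bar>\<^sup>2\<close> into a
  bound at an arbitrary point.\<close>

lemma schwarz_pick_deriv:
  assumes f: "bounded_series f a" and w: "cmod w < 1"
  shows "cmod (deriv f w) * (1 - (cmod w)\<^sup>2) \<le> 1 - (cmod (f w))\<^sup>2"
proof -
  define M where "M = (\<lambda>z. (z + w) / (1 + cnj w * z))"
  have M: "M = Moebius_function 0 (- w)"
    by (simp add: M_def Moebius_function_simple fun_eq_iff)
  have M1: "cmod (M z) < 1" if "cmod z < 1" for z
    unfolding M using that w by (intro Moebius_function_norm_lt_1) auto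
  have holM: "M holomorphic_on ball 0 1"
    unfolding M using w by (intro Moebius_function_holomorphic) auto
  define h where "h = (\<lambda>z. f (M z))"
  have "h holomorphic_on ball 0 1"
    unfolding h_def
    by (rule holomorphic_on_compose_gen[OF holM bounded_series_holomorphic[OF f], unfolded o_def])
       (use M1 in auto)
  then have h: "bounded_series h (\<lambda>n. (deriv ^^ n) h 0 / fact n)"
    using bounded_series_le[OF f] M1 by (intro holomorphic_bounded_series) (auto simp: h_def)
  have "(M has_field_derivative (1 - of_real ((cmod w)\<^sup>2))) (at 0)"
    unfolding M_def complex_norm_square
    by (auto intro!: derivative_eq_intros simp: mult.commute)
  moreover have "(f has_field_derivative deriv f w) (at (M 0))"
    using holomorphic_derivI[OF bounded_series_holomorphic[OF f], of w] w by (simp add: M_def)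
  ultimately have "(h has_field_derivative deriv f w * (1 - of_real ((cmod w)\<^sup>2))) (at 0)"
    unfolding h_def using DERIV_chain2 by blast
  then have dh: "deriv h 0 = deriv f w * (1 - of_real ((cmod w)\<^sup>2))" by (rule DERIV_imp_deriv)
  have "cmod (1 - of_real ((cmod w)\<^sup>2)) = 1 - (cmod w)\<^sup>2"
  proof -
    have "cmod (1 - of_real ((cmod w)\<^sup>2)) = cmod (of_real (1 - (cmod w)\<^sup>2))" by simp
    also have "\<dots> = \<bar>1 - (cmod w)\<^sup>2\<bar>" by (rule norm_of_real)
    finally show ?thesis using w by (simp add: abs_square_le_1)
  qed
  then show ?thesis
    using coefficient_le[OF h, of 1] dh by (simp add: h_def M_def norm_mult del: of_real_power)
qed

section \<open>Area of the image\<close>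

lemma bounded_series_deriv_sums:
  assumes f: "bounded_series f a" and z: "cmod z < 1"
  shows "(\<lambda>n. of_nat (n + 1) * a (n + 1) * z ^ n) sums deriv f z"
proof -
  let ?K = "of_real ((1 + cmod z) / 2) :: complex"
  have K: "cmod ?K = (1 + cmod z) / 2" unfolding norm_of_real by simp
  have summ: "summable (\<lambda>n. a n * x ^ n)" if "cmod x < 1" for x
    using bounded_series_sums[OF f that] by (rule sums_summable)
  have "((\<lambda>x. \<Sum>n. a n * x ^ n) has_field_derivative (\<Sum>n. diffs a n * z ^ n)) (at z)"
    by (rule termdiffs_strong[of a ?K]) (use summ[of ?K] z in \<open>simp_all only: K, simp_all\<close>)
  moreover have "eventually (\<lambda>x. (\<Sum>n. a n * x ^ n) = f x) (nhds z)"
    using eventually_nhds_in_open[of "ball 0 1" z] z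
    by (auto elim!: eventually_mono dest!: bounded_series_sums[OF f] sums_unique)
  ultimately have "(f has_field_derivative (\<Sum>n. diffs a n * z ^ n)) (at z)"
    by (subst (asm) DERIV_cong_ev[OF refl _ refl])
  then have "deriv f z = (\<Sum>n. diffs a n * z ^ n)" by (rule DERIV_imp_deriv)
  moreover have "summable (\<lambda>n. diffs a n * z ^ n)"
    by (rule termdiff_converges[of z 1]) (use z summ in auto)
  ultimately show ?thesis by (simp add: sums_iff diffs_def)
qed

text \<open>Parseval for \<open>deriv f\<close>: the factor (n + 1)^2 from differentiation against
  the area weight 1 / (n + 1) leaves n + 1. Parseval is stated for positive radii, so r = 0 is
  treated apart.\<close>

lemma image_area_sums:
  assumes f: "bounded_series f a" and r: "0 \<le> r" "r < 1"
  shows "(\<lambda>n. pi * (real (n + 1) * (cmod (a (n + 1)))\<^sup>2 * r ^ (2 * (n + 1)))) sums image_area f r"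
proof (cases "r = 0")
  case True
  then show ?thesis by (simp add: image_area_def set_lebesgue_integral_def)
next
  case False
  have "pi * ((cmod (of_nat (n + 1) * a (n + 1)))\<^sup>2 * r ^ (2 * n + 2) / (n + 1))
      = pi * (real (n + 1) * (cmod (a (n + 1)))\<^sup>2 * r ^ (2 * (n + 1)))" for n
    unfolding norm_mult norm_of_nat power_mult_distrib by (simp add: power2_eq_square)
  then show ?thesis
    unfolding image_area_def
    using parseval_ball[OF bounded_series_deriv_sums[OF f], of r] r False by simp
qed

lemma sums_Suc_power:
  fixes x :: real
  assumes "\<bar>x\<bar> < 1"
  shows "(\<lambda>n. real (n + 1) * x ^ (n + 1)) sums (x / (1 - x)\<^sup>2)"
  using sums_mult[OF geometric_deriv_sums[of x], of x] assms by (simp add: mult_ac)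

lemma image_area_bounds:
  assumes f: "bounded_series f a" and r: "0 \<le> r" "r < 1"
  shows "0 \<le> image_area f r"
    and "image_area f r \<le> pi * ((1 - (cmod (a 0))\<^sup>2)\<^sup>2 * r\<^sup>2 / (1 - r\<^sup>2)\<^sup>2)"
proof -
  show "0 \<le> image_area f r"
    by (rule sums_le[OF _ sums_zero image_area_sums[OF f r]]) (use r in auto)
  let ?A = "(1 - (cmod (a 0))\<^sup>2)\<^sup>2"
  have "r\<^sup>2 < 1" using r by (simp add: abs_square_less_1)
  then have s: "(\<lambda>n. pi * ?A * (real (n + 1) * (r\<^sup>2) ^ (n + 1))) sums (pi * ?A * (r\<^sup>2 / (1 - r\<^sup>2)\<^sup>2))"
    by (intro sums_mult sums_Suc_power) simp
  have "image_area f r \<le> pi * ?A * (r\<^sup>2 / (1 - r\<^sup>2)\<^sup>2)"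
  proof (rule sums_le[OF _ image_area_sums[OF f r] s])
    fix n :: nat
    have "(cmod (a (n + 1)))\<^sup>2 \<le> ?A"
      using coefficient_le[OF f, of "n + 1"] by (intro power_mono) auto
    then have "pi * real (n + 1) * r ^ (2 * (n + 1)) * (cmod (a (n + 1)))\<^sup>2
        \<le> pi * real (n + 1) * r ^ (2 * (n + 1)) * ?A"
      using r by (intro mult_left_mono) auto
    then show "pi * (real (n + 1) * (cmod (a (n + 1)))\<^sup>2 * r ^ (2 * (n + 1)))
        \<le> pi * ?A * (real (n + 1) * (r\<^sup>2) ^ (n + 1))"
      unfolding power_mult[of r 2 "n + 1"] by (simp only: mult_ac)
  qed
  then show "image_area f r \<le> pi * (?A * r\<^sup>2 / (1 - r\<^sup>2)\<^sup>2)" by (simp add: mult_ac)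
qed

section \<open>The inequality at the critical radius\<close>

text \<open>Many later sign conditions are linear in r_0, and some hold only narrowly, such as 1217
  r_0 > 341; hence the tight enclosure.\<close>

lemma r0_const_bounds: "2807 / 10000 < r0_const" "r0_const < 2808 / 10000"
proof -
  have "41228 / 10000 < sqrt 17" by (rule real_less_rsqrt) (simp add: power2_eq_square)
  moreover have "sqrt 17 < 41232 / 10000" by (rule real_less_lsqrt) (simp_all add: power2_eq_square)
  ultimately show "2807 / 10000 < r0_const" "r0_const < 2808 / 10000" by (simp_all add: r0_const_def)
qed

text \<open>Replaces the square root: modulo this relation every polynomial in r_0 reduces to a
  linear one, which is how the identities at the critical radius are checked.\<close>

lemma r0_const_quadratic: "2 * r0_const\<^sup>2 + 3 * r0_const = 1"
proof -
  have "4 * r0_const + 3 = sqrt 17" by (simp add: r0_const_def field_simps)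
  then have "(4 * r0_const + 3)\<^sup>2 = 17" by simp
  then show ?thesis by (simp add: power2_eq_square algebra_simps)
qed

lemma lambda_const_eq: "lambda_const = (23 - 43 * r0_const) / 16"
  by (simp add: lambda_const_def r0_const_def field_simps)

lemma lambda_const_nonneg: "lambda_const \<ge> 0"
  using r0_const_bounds by (simp add: lambda_const_eq)

text \<open>Linear normal forms at r_0 of the factor in the bound for the two series, of the area
  factor, and of lambda times the area factor.\<close>

lemma r0_const_quotients:
  shows "r0_const\<^sup>2 / (1 - r0_const) = (1 - 2 * r0_const) / 4"
    and "r0_const\<^sup>2 / (1 - r0_const\<^sup>2)\<^sup>2 = (11 - 18 * r0_const) / 64"
    and "lambda_const * ((11 - 18 * r0_const) / 64) = (5 - 16 * r0_const) / 8"
proof -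
  define r where "r = r0_const"
  have q: "2 * r\<^sup>2 + 3 * r = 1" using r0_const_quadratic by (simp add: r_def)
  have b: "0 < r" "r < 1" using r0_const_bounds by (simp_all add: r_def)
  then have r2: "r\<^sup>2 < 1" by (simp add: abs_square_less_1)
  have "4 * r\<^sup>2 = (1 - 2 * r) * (1 - r)" using q by algebra
  then show "r0_const\<^sup>2 / (1 - r0_const) = (1 - 2 * r0_const) / 4"
    unfolding r_def[symmetric] using b by (simp add: field_simps)
  have "64 * r\<^sup>2 = (11 - 18 * r) * (1 - r\<^sup>2)\<^sup>2" using q by algebra
  then show "r0_const\<^sup>2 / (1 - r0_const\<^sup>2)\<^sup>2 = (11 - 18 * r0_const) / 64"
    unfolding r_def[symmetric] using r2 by (simp add: divide_simps mult.commute)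
  have "(23 - 43 * r) * (11 - 18 * r) = 128 * (5 - 16 * r)" using q by algebra
  then show "lambda_const * ((11 - 18 * r0_const) / 64) = (5 - 16 * r0_const) / 8"
    unfolding lambda_const_eq r_def[symmetric] by (simp add: field_simps)
qed

lemma div_one_minus_mono:
  fixes x y :: real
  assumes "0 \<le> x" "x \<le> y" "y < 1"
  shows "x / (1 - x) \<le> y / (1 - y)"
  using assms by (intro frac_le) auto

lemma divide_le_divideI:
  fixes x y z w :: real
  assumes "0 < y" "0 < w" "x * w \<le> z * y"
  shows "x / y \<le> z / w"
  using assms by (simp add: divide_simps mult.commute)

section \<open>A majorant in A and r alone\<close>

text \<open>The second summand is r (1 - X^2) / (1 - r^2) with X = (A + r) / (1 + A r), the
  Schwarz-Pick bound for r |f'| where |f| = X. The last is lambda x / (1 - x) for the bound x on S_r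
  / pi.\<close>

definition bohr_majorant :: "real \<Rightarrow> real \<Rightarrow> real" where
  "bohr_majorant A r = (A + r) / (1 + A * r) + (1 - A\<^sup>2) * (r / (1 + A * r)\<^sup>2)
    + (1 - A\<^sup>2) * (r\<^sup>2 / (1 - r))
    + lambda_const * ((1 - A\<^sup>2)\<^sup>2 * (r\<^sup>2 / (1 - r\<^sup>2)\<^sup>2) / (1 - (1 - A\<^sup>2)\<^sup>2 * (r\<^sup>2 / (1 - r\<^sup>2)\<^sup>2)))"

text \<open>Each of the four summands is nondecreasing in \<open>r\<close> separately; the
  hypothesis on \<open>s\<close> keeps the denominator of the area quotient positive.\<close>

lemma bohr_majorant_mono:
  assumes A: "0 \<le> A" "A \<le> 1" and r: "0 \<le> r" "r \<le> s" "s < 1"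
    and B: "(1 - A\<^sup>2)\<^sup>2 * (s\<^sup>2 / (1 - s\<^sup>2)\<^sup>2) < 1"
  shows "bohr_majorant A r \<le> bohr_majorant A s"
proof -
  have A2: "A\<^sup>2 \<le> 1" using A by (simp add: abs_square_le_1)
  have s: "0 \<le> s" and s2: "s\<^sup>2 < 1" using r by (auto simp: abs_square_less_1)
  have rs: "r\<^sup>2 \<le> s\<^sup>2" using r by (intro power_mono) auto
  have pos: "1 + A * r > 0" "1 + A * s > 0" using A r by (simp_all add: add_pos_nonneg)
  have "(A + r) * (1 + A * s) \<le> (A + s) * (1 + A * r)"
  proof -
    have "(A + s) * (1 + A * r) - (A + r) * (1 + A * s) = (s - r) * (1 - A\<^sup>2)"
      by (simp add: algebra_simps power2_eq_square)
    then show ?thesis using A2 r mult_nonneg_nonneg[of "s - r" "1 - A\<^sup>2"] by linarith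
  qed
  then have 1: "(A + r) / (1 + A * r) \<le> (A + s) / (1 + A * s)"
    by (rule divide_le_divideI[OF pos])
  have "r * (1 + A * s)\<^sup>2 \<le> s * (1 + A * r)\<^sup>2"
  proof -
    have "s * (1 + A * r)\<^sup>2 - r * (1 + A * s)\<^sup>2 = (s - r) * (1 - A\<^sup>2 * (r * s))"
      by (simp add: algebra_simps power2_eq_square)
    moreover have "A\<^sup>2 * (r * s) \<le> 1 * (1 * 1)"
      using A2 r s by (intro mult_mono) auto
    ultimately show ?thesis using r mult_nonneg_nonneg[of "s - r" "1 - A\<^sup>2 * (r * s)"] by linarith
  qed
  then have 2: "r / (1 + A * r)\<^sup>2 \<le> s / (1 + A * s)\<^sup>2"
    using pos by (intro divide_le_divideI) auto
  have 3: "r\<^sup>2 / (1 - r) \<le> s\<^sup>2 / (1 - s)" using rs r by (intro frac_le) auto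
  have "r\<^sup>2 / (1 - r\<^sup>2)\<^sup>2 \<le> s\<^sup>2 / (1 - s\<^sup>2)\<^sup>2"
    using rs s2 by (intro frac_le[OF _ rs] power_mono) auto
  then have "(1 - A\<^sup>2)\<^sup>2 * (r\<^sup>2 / (1 - r\<^sup>2)\<^sup>2) \<le> (1 - A\<^sup>2)\<^sup>2 * (s\<^sup>2 / (1 - s\<^sup>2)\<^sup>2)"
    by (intro mult_left_mono) auto
  then have 4: "(1 - A\<^sup>2)\<^sup>2 * (r\<^sup>2 / (1 - r\<^sup>2)\<^sup>2) / (1 - (1 - A\<^sup>2)\<^sup>2 * (r\<^sup>2 / (1 - r\<^sup>2)\<^sup>2))
      \<le> (1 - A\<^sup>2)\<^sup>2 * (s\<^sup>2 / (1 - s\<^sup>2)\<^sup>2) / (1 - (1 - A\<^sup>2)\<^sup>2 * (s\<^sup>2 / (1 - s\<^sup>2)\<^sup>2))"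
    using B by (intro div_one_minus_mono) auto
  show ?thesis
    unfolding bohr_majorant_def using A2 lambda_const_nonneg
    by (intro add_mono mult_left_mono 1 2 3 4) auto
qed

text \<open>In terms of \<open>e = 1 - A\<close> the deficit at \<open>r\<^sub>0\<close> vanishes to third order: the choice of \<open>r\<^sub>0\<close> kills the
  coefficient of \<open>e\<close> and the choice of \<open>\<lambda>\<close> that of \<open>e\<^sup>2\<close>.\<close>

lemma bohr_majorant_r0_aux:
  fixes e r :: real
  assumes q: "2 * r\<^sup>2 + 3 * r = 1" and b: "2807 / 10000 < r" "r < 2808 / 10000" and e: "0 \<le> e" "e \<le> 1"
  shows "(1 - e + r) / (1 + (1 - e) * r) + (1 - (1 - e)\<^sup>2) * (r / (1 + (1 - e) * r)\<^sup>2)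
    + (1 - (1 - e)\<^sup>2) * ((1 - 2 * r) / 4)
    + (5 - 16 * r) / 8 * (e\<^sup>2 * (2 - e)\<^sup>2 * (1 + e / 4)) \<le> 1"
proof -
  define D where "D = 1 + (1 - e) * r"
  have D: "D > 0" using e b by (simp add: D_def add_pos_nonneg)
  define U where "U = (1 - (1 - e)\<^sup>2) * ((1 - 2 * r) / 4)
    + (5 - 16 * r) / 8 * (e\<^sup>2 * (2 - e)\<^sup>2 * (1 + e / 4))"
  \<comment> \<open>The deficit times D^2, divided by e^3 and reduced by \<open>q\<close> to
    coefficients linear in \<open>r\<close>.\<close>
  define Q where "Q = (101 - 337 * r) / 16 - (93 - 327 * r) / 8 * e - (1217 * r - 341) / 64 * e\<^sup>2
    + (13 - 45 * r) / 32 * e ^ 3 - (29 - 103 * r) / 64 * e ^ 4"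
  have key: "D\<^sup>2 - ((1 - e + r) * D + (1 - (1 - e)\<^sup>2) * r + U * D\<^sup>2) = e ^ 3 * Q"
    unfolding D_def U_def Q_def using q by algebra
  have "Q \<ge> 0"
  proof -
    define c1 c2 c3 c4 where "c1 = (93 - 327 * r) / 8" and "c2 = (1217 * r - 341) / 64"
      and "c3 = (13 - 45 * r) / 32" and "c4 = (29 - 103 * r) / 64"
    have c: "0 \<le> c1" "0 \<le> c2" "0 \<le> c3" "0 \<le> c4" "c1 + c2 + c4 \<le> (101 - 337 * r) / 16"
      using b by (simp_all add: c1_def c2_def c3_def c4_def field_simps)
    \<comment> \<open>The subtracted terms are largest at e = 1, and even there the constant term
      outweighs them.\<close>
    have "c1 * e \<le> c1 * 1" "c2 * e\<^sup>2 \<le> c2 * 1" "c4 * e ^ 4 \<le> c4 * 1"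
      using c e by (intro mult_left_mono power_le_one; simp)+
    moreover have "c3 * e ^ 3 \<ge> 0" using c e by simp
    ultimately show ?thesis
      unfolding Q_def c1_def[symmetric] c2_def[symmetric] c3_def[symmetric] c4_def[symmetric]
      using c by linarith
  qed
  then have "e ^ 3 * Q \<ge> 0" using e by simp
  then have "(1 - e + r) * D + (1 - (1 - e)\<^sup>2) * r + U * D\<^sup>2 \<le> D\<^sup>2"
    using key by linarith
  then have "((1 - e + r) * D + (1 - (1 - e)\<^sup>2) * r + U * D\<^sup>2) / D\<^sup>2 \<le> 1"
    using D by (simp add: divide_simps)
  moreover have "((1 - e + r) * D + (1 - (1 - e)\<^sup>2) * r + U * D\<^sup>2) / D\<^sup>2
      = (1 - e + r) / D + (1 - (1 - e)\<^sup>2) * (r / D\<^sup>2) + U"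
    using D by (simp add: add_divide_distrib power2_eq_square)
  ultimately show ?thesis unfolding D_def[symmetric] U_def by linarith
qed

lemma bohr_majorant_r0:
  assumes A: "0 \<le> A" "A \<le> 1"
  shows "(1 - A\<^sup>2)\<^sup>2 * (r0_const\<^sup>2 / (1 - r0_const\<^sup>2)\<^sup>2) < 1" and "bohr_majorant A r0_const \<le> 1"
proof -
  define e where "e = 1 - A"
  define \<beta> where "\<beta> = (11 - 18 * r0_const) / 64"
  have e: "0 \<le> e" "e \<le> 1" "A = 1 - e" using A by (simp_all add: e_def)
  define B where "B = (1 - A\<^sup>2)\<^sup>2 * \<beta>"
  have Be: "B = \<beta> * (e\<^sup>2 * (2 - e)\<^sup>2)"
    unfolding B_def e(3) by (simp add: power2_eq_square algebra_simps)
  have \<beta>: "0 \<le> \<beta>" "\<beta> \<le> 93 / 1000" using r0_const_bounds by (simp_all add: \<beta>_def)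
  have B0: "0 \<le> B" using \<beta> by (simp add: B_def)
  \<comment> \<open>One factor e (2 - e) is bounded by 1 and the other by 2 e, so that
    \<open>B\<close> is at most linear in \<open>e\<close>.\<close>
  have "e * (2 - e) \<le> 1"
    using sum_squares_bound[of e 1] by (simp add: power2_eq_square algebra_simps)
  then have "(e * (2 - e)) * (e * (2 - e)) \<le> 1 * (e * 2)"
    using e by (intro mult_mono) auto
  then have "B \<le> (93 / 1000) * (e * 2)"
    unfolding Be using \<beta> e by (intro mult_mono[OF \<beta>(2)]) (auto simp: power2_eq_square mult_ac)
  then have B1: "B \<le> (186 / 1000) * e" by simp
  then show "(1 - A\<^sup>2)\<^sup>2 * (r0_const\<^sup>2 / (1 - r0_const\<^sup>2)\<^sup>2) < 1"
    using e by (simp add: r0_const_quotients(2) B_def \<beta>_def)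
  \<comment> \<open>As 0.186 times 1.25 is below 1/4, this gives B (1 + e/4) \<le> e/4, which is 1 /
    (1 - B) \<le> 1 + e/4 rearranged: the area quotient gets a polynomial bound.\<close>
  have "B * (1 + e / 4) \<le> (186 / 1000) * e * (125 / 100)"
    using B1 B0 e by (intro mult_mono) auto
  then have "0 \<le> B * (e / 4 - B * (1 + e / 4))" using B0 e by simp
  then have "B \<le> (B * (1 + e / 4)) * (1 - B)" by (simp add: algebra_simps)
  then have "B / (1 - B) \<le> B * (1 + e / 4)"
    using B1 e by (simp add: divide_le_eq)
  then have "lambda_const * (B / (1 - B)) \<le> lambda_const * (B * (1 + e / 4))"
    using lambda_const_nonneg by (rule mult_left_mono)
  also have "\<dots> = (lambda_const * \<beta>) * (e\<^sup>2 * (2 - e)\<^sup>2 * (1 + e / 4))"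
    unfolding Be by (simp only: mult_ac)
  also have "lambda_const * \<beta> = (5 - 16 * r0_const) / 8"
    unfolding \<beta>_def by (rule r0_const_quotients(3))
  finally have "lambda_const * (B / (1 - B))
      \<le> (5 - 16 * r0_const) / 8 * (e\<^sup>2 * (2 - e)\<^sup>2 * (1 + e / 4))" .
  moreover have "bohr_majorant A r0_const = (A + r0_const) / (1 + A * r0_const)
      + (1 - A\<^sup>2) * (r0_const / (1 + A * r0_const)\<^sup>2) + (1 - A\<^sup>2) * ((1 - 2 * r0_const) / 4)
      + lambda_const * (B / (1 - B))"
    unfolding bohr_majorant_def r0_const_quotients(1,2) B_def \<beta>_def ..
  ultimately show "bohr_majorant A r0_const \<le> 1"
    using bohr_majorant_r0_aux[OF r0_const_quadratic r0_const_bounds e(1,2)] unfolding e(3) by linarith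
qed

lemma bohr_lhs_le_majorant:
  assumes f: "bounded_series f a" and z: "cmod z \<le> r0_const"
  shows "bohr_lhs lambda_const f a z \<le> bohr_majorant (cmod (a 0)) (cmod z)"
proof -
  define r where "r = cmod z"
  define A where "A = cmod (a 0)"
  have r: "0 \<le> r" "r < 2808 / 10000" "r < 1" "cmod z < 1" using z r0_const_bounds by (auto simp: r_def)
  have A: "0 \<le> A" "A \<le> 1"
    using bounded_series_le[OF f, of 0] bounded_series_0[OF f] by (auto simp: A_def)
  have A2: "A\<^sup>2 \<le> 1" using A by (simp add: abs_square_le_1)
  have r2: "r\<^sup>2 \<le> (2808 / 10000) * r" unfolding power2_eq_square using r by (intro mult_right_mono) auto
  have pos: "1 + A * r > 0" using A r by (simp add: add_pos_nonneg)
  define x where "x = cmod (f z)"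
  define X where "X = (A + r) / (1 + A * r)"
  have xX: "x \<le> X" unfolding x_def X_def A_def r_def by (rule schwarz_pick_growth[OF f r(4)])
  have X1: "X \<le> 1"
  proof -
    have "(1 - A) * (1 - r) \<ge> 0" using A r by simp
    then have "A + r \<le> 1 + A * r" by (simp add: algebra_simps)
    then show ?thesis using pos by (simp add: X_def divide_le_eq)
  qed
  have "cmod (deriv f z) \<le> (1 - x\<^sup>2) / (1 - r\<^sup>2)"
    using schwarz_pick_deriv[OF f r(4)] r r2 by (simp add: x_def r_def pos_le_divide_eq)
  then have "x + cmod (deriv f z) * r \<le> x + (1 - x\<^sup>2) / (1 - r\<^sup>2) * r"
    using r by (intro add_left_mono mult_right_mono) auto
  \<comment> \<open>The function x + r (1 - x^2) / (1 - r^2) increases for x up to 1 whenever 2 r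
    \<le> 1 - r^2, that is r \<le> sqrt 2 - 1. Since r_0 is smaller, the growth bound may be
    inserted into both terms at once.\<close>
  also have "\<dots> \<le> X + (1 - X\<^sup>2) / (1 - r\<^sup>2) * r"
  proof -
    have "r * (X + x) \<le> r * 2" using xX X1 r by (intro mult_left_mono) auto
    also have "\<dots> \<le> 1 - r\<^sup>2" using r r2 by linarith
    finally have "(X - x) * (1 - r * (X + x) / (1 - r\<^sup>2)) \<ge> 0"
      using xX r r2 by (intro mult_nonneg_nonneg) (auto simp: divide_le_eq)
    moreover have "(X + (1 - X\<^sup>2) / (1 - r\<^sup>2) * r) - (x + (1 - x\<^sup>2) / (1 - r\<^sup>2) * r)
        = (X - x) * (1 - r * (X + x) / (1 - r\<^sup>2))"
      using r r2 by (simp add: divide_simps) (simp add: algebra_simps power2_eq_square)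
    ultimately show ?thesis by linarith
  qed
  also have "(1 - X\<^sup>2) / (1 - r\<^sup>2) * r = (1 - A\<^sup>2) * (r / (1 + A * r)\<^sup>2)"
  proof -
    have "1 - X\<^sup>2 = (1 - A\<^sup>2) * (1 - r\<^sup>2) / (1 + A * r)\<^sup>2"
      using pos unfolding X_def
      by (simp add: power_divide divide_simps) (simp add: algebra_simps power2_eq_square)
    then show ?thesis using r r2 by simp
  qed
  finally have 1: "x + cmod (deriv f z) * r \<le> X + (1 - A\<^sup>2) * (r / (1 + A * r)\<^sup>2)" .
  define B where "B = (1 - A\<^sup>2)\<^sup>2 * (r\<^sup>2 / (1 - r\<^sup>2)\<^sup>2)"
  define S where "S = image_area f r"
  have S: "0 \<le> S" "S \<le> pi * B"
    using image_area_bounds[OF f r(1,3)] by (simp_all add: S_def B_def A_def)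
  have B1: "B < 1"
  proof -
    have "r\<^sup>2 / (1 - r\<^sup>2)\<^sup>2 \<le> r0_const\<^sup>2 / (1 - r0_const\<^sup>2)\<^sup>2"
      using z r r0_const_bounds abs_square_less_1[of r0_const]
      by (intro frac_le power_mono diff_left_mono) (auto simp: r_def)
    then have "B \<le> (1 - A\<^sup>2)\<^sup>2 * (r0_const\<^sup>2 / (1 - r0_const\<^sup>2)\<^sup>2)"
      unfolding B_def by (intro mult_left_mono) auto
    then show ?thesis using bohr_majorant_r0(1)[OF A] by simp
  qed
  have "S / (pi - S) = (S / pi) / (1 - S / pi)" by (simp add: divide_simps)
  also have "\<dots> \<le> B / (1 - B)"
    using S B1 by (intro div_one_minus_mono) (auto simp: divide_le_eq mult.commute)
  finally have 2: "lambda_const * (S / (pi - S)) \<le> lambda_const * (B / (1 - B))"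
    using lambda_const_nonneg by (rule mult_left_mono)
  have 3: "(\<Sum>n. cmod (a (n + 2)) * r ^ (n + 2))
      + (1 / (1 + A) + r / (1 - r)) * (\<Sum>n. (cmod (a (n + 1)))\<^sup>2 * r ^ (2 * (n + 1)))
      \<le> (1 - A\<^sup>2) * (r\<^sup>2 / (1 - r))"
    using refined_bohr_sum[OF f r(1,3)] unfolding A_def times_divide_eq_right .
  show ?thesis
    using 1 2 3
    unfolding bohr_lhs_def bohr_majorant_def Let_def r_def[symmetric] A_def[symmetric] S_def[symmetric]
      x_def[symmetric] X_def[symmetric] B_def[symmetric]
    by linarith
qed

lemma bohr_lhs_le_1:
  assumes f: "bounded_series f a" and z: "cmod z \<le> r0_const"
  shows "bohr_lhs lambda_const f a z \<le> 1"
proof -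
  have A: "0 \<le> cmod (a 0)" "cmod (a 0) \<le> 1"
    using bounded_series_le[OF f, of 0] bounded_series_0[OF f] by auto
  note bohr_lhs_le_majorant[OF f z]
  also have "bohr_majorant (cmod (a 0)) (cmod z) \<le> bohr_majorant (cmod (a 0)) r0_const"
    using z r0_const_bounds by (intro bohr_majorant_mono A bohr_majorant_r0(1)) auto
  also have "\<dots> \<le> 1" by (rule bohr_majorant_r0(2)[OF A])
  finally show ?thesis .
qed

section \<open>Sharpness\<close>

definition moebius_coeff :: "real \<Rightarrow> nat \<Rightarrow> complex" where
  "moebius_coeff A n = (if n = 0 then of_real A else of_real ((1 - A\<^sup>2) * (- A) ^ (n - 1)))"

definition moebius_map :: "real \<Rightarrow> complex \<Rightarrow> complex" where
  "moebius_map A z = (of_real A + z) / (1 + of_real A * z)"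

lemma moebius_denominator_nonzero:
  assumes "0 \<le> A" "A < 1" "cmod z < 1"
  shows "1 + of_real A * z \<noteq> 0"
proof
  assume "1 + of_real A * z = 0"
  then have "of_real A * z = - 1" by (simp add: eq_neg_iff_add_eq_0 add.commute)
  then have "cmod (of_real A * z) = 1" by simp
  then have "A * cmod z = 1" using assms by (simp add: norm_mult)
  moreover have "A * cmod z \<le> A" using assms by (intro mult_left_le) auto
  ultimately show False using assms by simp
qed

lemma bounded_series_moebius:
  assumes A: "0 \<le> A" "A < 1"
  shows "bounded_series (moebius_map A) (moebius_coeff A)"
proof -
  have eq: "moebius_map A = Moebius_function 0 (- of_real A)"
    by (simp add: fun_eq_iff moebius_map_def Moebius_function_simple add.commute)
  have hol: "moebius_map A holomorphic_on ball 0 1"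
    unfolding eq using A by (intro Moebius_function_holomorphic) simp
  have le: "cmod (moebius_map A z) \<le> 1" if "cmod z < 1" for z
    unfolding eq using A that by (intro less_imp_le Moebius_function_norm_lt_1) auto
  have "(\<lambda>n. moebius_coeff A n * z ^ n) sums moebius_map A z" if z: "cmod z < 1" for z
  proof -
    have nz: "1 + of_real A * z \<noteq> 0" by (rule moebius_denominator_nonzero[OF A z])
    have "cmod (- of_real A * z) < 1"
      using A z mult_strict_mono[of A 1 "cmod z" 1] by (simp add: norm_mult)
    then have "(\<lambda>n. (1 - of_real A ^ 2) * z * (- of_real A * z) ^ n)
        sums ((1 - of_real A ^ 2) * z * (1 / (1 - (- of_real A * z))))"
      by (intro sums_mult geometric_sums)
    also have "(\<lambda>n. (1 - of_real A ^ 2) * z * (- of_real A * z) ^ n)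
        = (\<lambda>n. moebius_coeff A (Suc n) * z ^ Suc n)"
      unfolding power_mult_distrib[of "- of_real A" z]
      by (simp add: fun_eq_iff moebius_coeff_def mult_ac)
    finally have "(\<lambda>n. moebius_coeff A n * z ^ n)
        sums ((1 - of_real A ^ 2) * z * (1 / (1 - (- of_real A * z))) + moebius_coeff A 0 * z ^ 0)"
      by (rule sums_Suc)
    also have "(1 - of_real A ^ 2) * z * (1 / (1 - (- of_real A * z))) + moebius_coeff A 0 * z ^ 0
        = moebius_map A z"
      using nz by (simp add: moebius_coeff_def moebius_map_def divide_simps)
        (simp add: algebra_simps power2_eq_square)
    finally show ?thesis .
  qed
  then show ?thesis
    using hol le by (simp add: bounded_series_def analytic_on_open)
qed

lemma norm_moebius_coeff_Suc:
  assumes "0 \<le> A" "A < 1"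
  shows "cmod (moebius_coeff A (n + 1)) = (1 - A\<^sup>2) * A ^ n"
proof -
  have "moebius_coeff A (n + 1) = of_real ((1 - A\<^sup>2) * (- A) ^ n)"
    by (simp add: moebius_coeff_def)
  then have "cmod (moebius_coeff A (n + 1)) = \<bar>(1 - A\<^sup>2) * (- A) ^ n\<bar>"
    by (simp only: norm_of_real)
  then show ?thesis using assms by (simp add: abs_mult power_abs abs_square_le_1)
qed

lemma image_area_moebius:
  assumes A: "0 \<le> A" "A < 1" and r: "0 \<le> r" "r < 1"
  shows "image_area (moebius_map A) r = pi * ((1 - A\<^sup>2)\<^sup>2 * r\<^sup>2 / (1 - A\<^sup>2 * r\<^sup>2)\<^sup>2)"
proof -
  let ?q = "A\<^sup>2 * r\<^sup>2"
  have "?q < 1"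
    using A r mult_strict_mono[of "A\<^sup>2" 1 "r\<^sup>2" 1] by (simp add: abs_square_less_1)
  then have "(\<lambda>n. (pi * ((1 - A\<^sup>2)\<^sup>2 * r\<^sup>2)) * (of_nat (Suc n) * ?q ^ n))
      sums ((pi * ((1 - A\<^sup>2)\<^sup>2 * r\<^sup>2)) * (1 / (1 - ?q)\<^sup>2))"
    by (intro sums_mult geometric_deriv_sums) simp
  moreover have eq: "pi * (real (n + 1) * (cmod (moebius_coeff A (n + 1)))\<^sup>2 * r ^ (2 * (n + 1)))
      = (pi * ((1 - A\<^sup>2)\<^sup>2 * r\<^sup>2)) * (of_nat (Suc n) * ?q ^ n)" for n
    unfolding norm_moebius_coeff_Suc[OF A] power_mult[of r 2 "n + 1"]
    by (simp add: power_mult_distrib power_mult[symmetric] mult_ac)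
  ultimately have "(\<lambda>n. pi * (real (n + 1) * (cmod (moebius_coeff A (n + 1)))\<^sup>2 * r ^ (2 * (n + 1))))
      sums ((pi * ((1 - A\<^sup>2)\<^sup>2 * r\<^sup>2)) * (1 / (1 - ?q)\<^sup>2))"
    by (simp only: eq)
  from sums_unique2[OF image_area_sums[OF bounded_series_moebius[OF A] r] this]
  show ?thesis by simp
qed

lemma deriv_moebius_map:
  assumes A: "0 \<le> A" "A < 1" and r: "0 \<le> r" "r < 1"
  shows "deriv (moebius_map A) (of_real r) = of_real ((1 - A\<^sup>2) / (1 + A * r)\<^sup>2)"
proof (rule DERIV_imp_deriv)
  have nz: "1 + complex_of_real A * of_real r \<noteq> 0"
    using moebius_denominator_nonzero[OF A, of "of_real r"] r by simp
  show "(moebius_map A has_field_derivative of_real ((1 - A\<^sup>2) / (1 + A * r)\<^sup>2)) (at (of_real r))"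
    unfolding moebius_map_def
    by (rule derivative_eq_intros refl nz | simp)+
       (simp add: power2_eq_square algebra_simps)
qed

text \<open>The disk automorphisms \<open>z \<mapsto> (A + z) / (1 + A z)\<close> are extremal for each of the estimates, except that
  the area term is only attained up to a factor tending to \<open>1\<close> as \<open>A \<rightarrow> 1\<close>.\<close>

lemma bohr_lhs_moebius:
  assumes A: "0 \<le> A" "A < 1" and r: "0 \<le> r" "r < 1"
  defines "C \<equiv> (1 - A\<^sup>2)\<^sup>2 * r\<^sup>2 / (1 - A\<^sup>2 * r\<^sup>2)\<^sup>2"
  shows "bohr_lhs \<mu> (moebius_map A) (moebius_coeff A) (of_real r)
    = (A + r) / (1 + A * r) + (1 - A\<^sup>2) * r / (1 + A * r)\<^sup>2 + (1 - A\<^sup>2) * r\<^sup>2 / (1 - r) + \<mu> * (C / (1 - C))"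
proof -
  have pos: "1 + A * r > 0" "1 - A * r > 0"
    using A r mult_strict_mono[of A 1 r 1] by (auto simp: add_pos_nonneg intro: order_le_less_trans[OF mult_left_le])
  have A2: "A\<^sup>2 < 1" using A by (simp add: abs_square_less_1)
  have nr: "cmod (of_real r) = r" using r by simp
  have fr: "cmod (moebius_map A (of_real r)) = (A + r) / (1 + A * r)"
  proof -
    have "moebius_map A (of_real r) = of_real ((A + r) / (1 + A * r))" by (simp add: moebius_map_def)
    then show ?thesis using A r pos by (simp only: norm_of_real) simp
  qed
  have dr: "cmod (deriv (moebius_map A) (of_real r)) = (1 - A\<^sup>2) / (1 + A * r)\<^sup>2"
    unfolding deriv_moebius_map[OF A r] using A2 by (simp only: norm_of_real) simp
  have a0: "cmod (moebius_coeff A 0) = A" using A by (simp add: moebius_coeff_def)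
  have q: "\<bar>A * r\<bar> < 1" "\<bar>A\<^sup>2 * r\<^sup>2\<bar> < 1"
    using A r pos mult_strict_mono[of "A\<^sup>2" 1 "r\<^sup>2" 1] by (auto simp: abs_square_less_1)
  have "(\<lambda>n. (1 - A\<^sup>2) * A * r\<^sup>2 * (A * r) ^ n) sums ((1 - A\<^sup>2) * A * r\<^sup>2 * (1 / (1 - A * r)))"
    using q by (intro sums_mult geometric_sums) simp
  moreover have "cmod (moebius_coeff A (n + 2)) * r ^ (n + 2) = (1 - A\<^sup>2) * A * r\<^sup>2 * (A * r) ^ n" for n
    using norm_moebius_coeff_Suc[OF A, of "n + 1"]
    by (simp add: power_mult_distrib power2_eq_square mult_ac)
  ultimately have s1: "(\<Sum>n. cmod (moebius_coeff A (n + 2)) * r ^ (n + 2)) = (1 - A\<^sup>2) * A * r\<^sup>2 / (1 - A * r)"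
    by (simp add: sums_iff)
  have "(\<lambda>n. (1 - A\<^sup>2)\<^sup>2 * r\<^sup>2 * (A\<^sup>2 * r\<^sup>2) ^ n) sums ((1 - A\<^sup>2)\<^sup>2 * r\<^sup>2 * (1 / (1 - A\<^sup>2 * r\<^sup>2)))"
    using q by (intro sums_mult geometric_sums) simp
  moreover have "(cmod (moebius_coeff A (n + 1)))\<^sup>2 * r ^ (2 * (n + 1))
      = (1 - A\<^sup>2)\<^sup>2 * r\<^sup>2 * (A\<^sup>2 * r\<^sup>2) ^ n" for n
    unfolding norm_moebius_coeff_Suc[OF A] power_mult[of r 2 "n + 1"]
    by (simp add: power_mult_distrib power_mult[symmetric] mult_ac)
  ultimately have s2: "(\<Sum>n. (cmod (moebius_coeff A (n + 1)))\<^sup>2 * r ^ (2 * (n + 1)))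
      = (1 - A\<^sup>2)\<^sup>2 * r\<^sup>2 / (1 - A\<^sup>2 * r\<^sup>2)"
    by (simp add: sums_iff)
  \<comment> \<open>Equality in \<open>refined_bohr_sum\<close>: the weight equals (1 + A r) / ((1 +
    A) (1 - r)), whose numerator cancels a factor of 1 - A^2 r^2.\<close>
  have comb: "(1 - A\<^sup>2) * A * r\<^sup>2 / (1 - A * r)
      + (1 / (1 + A) + r / (1 - r)) * ((1 - A\<^sup>2)\<^sup>2 * r\<^sup>2 / (1 - A\<^sup>2 * r\<^sup>2)) = (1 - A\<^sup>2) * r\<^sup>2 / (1 - r)"
  proof -
    have "1 - A\<^sup>2 * r\<^sup>2 = (1 + A * r) * (1 - A * r)" "1 - A\<^sup>2 = (1 + A) * (1 - A)"
      by (simp_all add: algebra_simps power2_eq_square)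
    moreover have "1 / (1 + A) + r / (1 - r) = (1 + A * r) / ((1 + A) * (1 - r))"
      using A r by (simp add: divide_simps) (simp add: algebra_simps)
    ultimately have "(1 / (1 + A) + r / (1 - r)) * ((1 - A\<^sup>2)\<^sup>2 * r\<^sup>2 / (1 - A\<^sup>2 * r\<^sup>2))
        = (1 - A\<^sup>2) * (1 - A) * r\<^sup>2 / ((1 - r) * (1 - A * r))"
      using A r pos by (simp add: power2_eq_square)
    moreover have "(1 - A\<^sup>2) * A * r\<^sup>2 / (1 - A * r) + (1 - A\<^sup>2) * (1 - A) * r\<^sup>2 / ((1 - r) * (1 - A * r))
        = (1 - A\<^sup>2) * r\<^sup>2 * (A * (1 - r) + (1 - A)) / ((1 - r) * (1 - A * r))"
      using r pos by (simp add: divide_simps) (simp add: algebra_simps)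
    moreover have "A * (1 - r) + (1 - A) = 1 - A * r" by (simp add: algebra_simps)
    ultimately show ?thesis using pos by simp
  qed
  have area: "image_area (moebius_map A) r / (pi - image_area (moebius_map A) r) = C / (1 - C)"
  proof -
    have "image_area (moebius_map A) r / (pi - image_area (moebius_map A) r)
        = (pi * C) / (pi * (1 - C))"
      unfolding image_area_moebius[OF A r] C_def by (simp add: right_diff_distrib)
    then show ?thesis by simp
  qed
  show ?thesis
    unfolding bohr_lhs_def Let_def nr fr dr a0 s1 s2 area using comb by simp
qed

section \<open>Necessary conditions as A tends to 1\<close>

text \<open>The inequality for the Moebius map divided by 1 - A, after lowering C / (1 - C) to C.
  The left side keeps a further factor 1 - A, so in the limit it is the right side that restricts
  \<open>r\<close>; where the limit of the right side is zero, the next order restricts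
  \<open>\<mu>\<close>.\<close>

lemma moebius_necessary_condition:
  assumes A: "0 \<le> A" "A < 1" and r: "0 \<le> r" "r < 1" and \<mu>: "0 \<le> \<mu>"
    and le: "bohr_lhs \<mu> (moebius_map A) (moebius_coeff A) (of_real r) \<le> 1"
  shows "\<mu> * (1 - A) * (1 + A)\<^sup>2 * r\<^sup>2 / (1 - A\<^sup>2 * r\<^sup>2)\<^sup>2
    \<le> (1 - r) / (1 + A * r) - (1 + A) * r / (1 + A * r)\<^sup>2 - (1 + A) * r\<^sup>2 / (1 - r)"
proof -
  define C where "C = (1 - A\<^sup>2)\<^sup>2 * r\<^sup>2 / (1 - A\<^sup>2 * r\<^sup>2)\<^sup>2"
  have pos: "1 + A * r > 0" using A r by (simp add: add_pos_nonneg)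
  have A2: "A\<^sup>2 < 1" using A by (simp add: abs_square_less_1)
  \<comment> \<open>Squared, this says that the image area stays below pi.\<close>
  have "(1 - A\<^sup>2) * r < 1 - A\<^sup>2 * r\<^sup>2"
  proof -
    have "(1 - A\<^sup>2 * r\<^sup>2) - (1 - A\<^sup>2) * r = (1 - r) * (1 + A\<^sup>2 * r)"
      by (simp add: algebra_simps power2_eq_square)
    moreover have "(1 - r) * (1 + A\<^sup>2 * r) > 0"
      using A r by (intro mult_pos_pos) (simp_all add: add_pos_nonneg)
    ultimately show ?thesis by linarith
  qed
  then have "((1 - A\<^sup>2) * r)\<^sup>2 < (1 - A\<^sup>2 * r\<^sup>2)\<^sup>2" using A2 r by (intro power_strict_mono) auto
  then have C: "0 \<le> C" "C < 1"
    by (auto simp: C_def power_mult_distrib divide_less_eq)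
  have "C * (1 - C) \<le> C * 1" using C by (intro mult_left_mono) auto
  then have "C \<le> C / (1 - C)" using C by (simp add: le_divide_eq)
  then have "\<mu> * C \<le> \<mu> * (C / (1 - C))" using \<mu> by (rule mult_left_mono)
  then have "\<mu> * C \<le> 1 - (A + r) / (1 + A * r) - (1 - A\<^sup>2) * r / (1 + A * r)\<^sup>2 - (1 - A\<^sup>2) * r\<^sup>2 / (1 - r)"
    using le unfolding bohr_lhs_moebius[OF A r] C_def[symmetric] by linarith
  also have "1 - (A + r) / (1 + A * r) = (1 - A) * ((1 - r) / (1 + A * r))"
    using pos by (simp add: divide_simps) (simp add: algebra_simps)
  also have "(1 - A) * ((1 - r) / (1 + A * r)) - (1 - A\<^sup>2) * r / (1 + A * r)\<^sup>2 - (1 - A\<^sup>2) * r\<^sup>2 / (1 - r)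
      = (1 - A) * ((1 - r) / (1 + A * r) - (1 + A) * r / (1 + A * r)\<^sup>2 - (1 + A) * r\<^sup>2 / (1 - r))"
  proof -
    have "1 - A\<^sup>2 = (1 - A) * (1 + A)" by (simp add: algebra_simps power2_eq_square)
    then show ?thesis by (simp add: right_diff_distrib mult.assoc)
  qed
  finally have main: "\<mu> * C \<le> (1 - A) * ((1 - r) / (1 + A * r) - (1 + A) * r / (1 + A * r)\<^sup>2 - (1 + A) * r\<^sup>2 / (1 - r))" .
  have "(1 - A\<^sup>2)\<^sup>2 = (1 - A) * ((1 - A) * (1 + A)\<^sup>2)" by (simp add: algebra_simps power2_eq_square)
  then have "\<mu> * C = (1 - A) * (\<mu> * (1 - A) * (1 + A)\<^sup>2 * r\<^sup>2 / (1 - A\<^sup>2 * r\<^sup>2)\<^sup>2)"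
    unfolding C_def by (simp add: mult_ac)
  from main[unfolded this] show ?thesis by (rule mult_left_le_imp_le) (use A in simp)
qed

lemma eventually_at_left_1: "eventually (\<lambda>A::real. 0 < A \<and> A < 1) (at_left 1)"
  using eventually_at_left_real[of 0 1] by (simp add: greaterThanLessThan_def)

text \<open>With the nonnegative area term dropped, letting A tend to 1 leaves the first-order
  coefficient, whose sign is that of 1 - 3 r - 2 r^2.\<close>

lemma radius_necessary_condition:
  assumes r: "0 \<le> r" "r < 1"
    and le: "\<And>A. 0 < A \<Longrightarrow> A < 1 \<Longrightarrow>
      bohr_lhs lambda_const (moebius_map A) (moebius_coeff A) (of_real r) \<le> 1"
  shows "r \<le> r0_const"
proof -
  let ?G = "\<lambda>A. (1 - r) / (1 + A * r) - (1 + A) * r / (1 + A * r)\<^sup>2 - (1 + A) * r\<^sup>2 / (1 - r)"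
  have nz: "1 + 1 * r \<noteq> 0" "1 - r \<noteq> 0" using r by auto
  have "0 \<le> ?G 1"
  proof (rule tendsto_lowerbound)
    show "(?G \<longlongrightarrow> ?G 1) (at_left 1)" by (intro tendsto_intros) (use nz in auto)
    show "\<forall>\<^sub>F A in at_left 1. 0 \<le> ?G A"
      using eventually_at_left_1
    proof eventually_elim
      case (elim A)
      have "0 \<le> lambda_const * (1 - A) * (1 + A)\<^sup>2 * r\<^sup>2 / (1 - A\<^sup>2 * r\<^sup>2)\<^sup>2"
        using elim lambda_const_nonneg by simp
      also have "\<dots> \<le> ?G A"
        using elim r lambda_const_nonneg le by (intro moebius_necessary_condition) auto
      finally show ?case .
    qed
  qed simp
  also have "?G 1 = (1 + r\<^sup>2) * (1 - 3 * r - 2 * r\<^sup>2) / ((1 + r)\<^sup>2 * (1 - r))"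
    using nz by (simp add: divide_simps) (simp add: algebra_simps power2_eq_square)
  finally have "0 \<le> (1 + r\<^sup>2) * (1 - 3 * r - 2 * r\<^sup>2)"
    using r by (simp add: zero_le_divide_iff zero_le_mult_iff mult_le_0_iff)
  moreover have "1 + r\<^sup>2 > 0" by (simp add: add_pos_nonneg)
  ultimately have q: "2 * r\<^sup>2 + 3 * r \<le> 1" by (simp add: zero_le_mult_iff)
  show ?thesis
  proof (rule ccontr)
    assume "\<not> r \<le> r0_const"
    then have "r0_const < r" "r0_const\<^sup>2 \<le> r\<^sup>2" using r0_const_bounds by (auto intro: power_mono)
    then show False using q r0_const_quadratic by linarith
  qed
qed

text \<open>At \<open>r\<^sub>0\<close> the right-hand side of the necessary condition is divisible by \<open>1 - A\<close>.\<close>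

lemma lambda_necessary_condition:
  assumes \<mu>: "0 \<le> \<mu>"
    and le: "\<And>A. 0 < A \<Longrightarrow> A < 1 \<Longrightarrow>
      bohr_lhs \<mu> (moebius_map A) (moebius_coeff A) (of_real r0_const) \<le> 1"
  shows "\<mu> \<le> lambda_const"
proof -
  define r where "r = r0_const"
  have q: "2 * r\<^sup>2 + 3 * r = 1" using r0_const_quadratic by (simp add: r_def)
  have r: "2807 / 10000 < r" "r < 2808 / 10000" "0 \<le> r" "r < 1"
    using r0_const_bounds by (simp_all add: r_def)
  have r2: "r\<^sup>2 < 1" using r by (simp add: abs_square_less_1)
  \<comment> \<open>The right side of the necessary condition, times (1 + A r)^2, divided by 1 - A
    and reduced modulo \<open>q\<close>. In powers of 1 - A only the constant term survives the
    limit.\<close>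
  let ?K = "\<lambda>A. (7 - 19 * r) / 4 + (5 * r - 3 / 2) * (1 - A) + (2 - 7 * r) / 4 * (1 - A)\<^sup>2"
  let ?L = "\<lambda>A. \<mu> * (1 + A)\<^sup>2 * r\<^sup>2 / (1 - A\<^sup>2 * r\<^sup>2)\<^sup>2"
  have "?L 1 \<le> ?K 1 / (1 + 1 * r)\<^sup>2"
  proof (rule tendsto_le)
    show "((\<lambda>A. ?K A / (1 + A * r)\<^sup>2) \<longlongrightarrow> ?K 1 / (1 + 1 * r)\<^sup>2) (at_left 1)"
      by (intro tendsto_intros) (use r in auto)
    show "(?L \<longlongrightarrow> ?L 1) (at_left 1)" by (intro tendsto_intros) (use r2 in auto)
    show "\<forall>\<^sub>F A in at_left 1. ?L A \<le> ?K A / (1 + A * r)\<^sup>2"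
      using eventually_at_left_1
    proof eventually_elim
      case (elim A)
      have pos: "1 + A * r > 0" using elim r by (simp add: add_pos_nonneg)
      have "(1 - A) * ?L A = \<mu> * (1 - A) * (1 + A)\<^sup>2 * r\<^sup>2 / (1 - A\<^sup>2 * r\<^sup>2)\<^sup>2" by simp
      also have "\<dots> \<le> (1 - r) / (1 + A * r) - (1 + A) * r / (1 + A * r)\<^sup>2 - (1 + A) * r\<^sup>2 / (1 - r)"
        using elim r \<mu> le by (intro moebius_necessary_condition) (auto simp: r_def)
      also have "\<dots> = (1 - r) / (1 + A * r) - (1 + A) * r / (1 + A * r)\<^sup>2 - (1 + A) * ((1 - 2 * r) / 4)"
        using r0_const_quotients(1) by (simp only: r_def times_divide_eq_right[symmetric])
      also have "\<dots> = ((1 - r) * (1 + A * r) - (1 + A) * r - (1 + A) * ((1 - 2 * r) / 4) * (1 + A * r)\<^sup>2) / (1 + A * r)\<^sup>2"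
        using pos by (simp add: diff_divide_distrib power2_eq_square)
      also have "(1 - r) * (1 + A * r) - (1 + A) * r - (1 + A) * ((1 - 2 * r) / 4) * (1 + A * r)\<^sup>2 = (1 - A) * ?K A"
        using q by algebra
      finally have "(1 - A) * ?L A \<le> (1 - A) * (?K A / (1 + A * r)\<^sup>2)" by simp
      then show ?case by (rule mult_left_le_imp_le) (use elim in simp)
    qed
  qed simp
  then have "\<mu> * (4 * (r\<^sup>2 / (1 - r\<^sup>2)\<^sup>2)) \<le> (7 - 19 * r) / 4 / (1 + r)\<^sup>2" by simp
  also have "(7 - 19 * r) / 4 / (1 + r)\<^sup>2 = (5 - 16 * r) / 2"
  proof -
    have "(7 - 19 * r) * 2 = (5 - 16 * r) * (4 * (1 + r)\<^sup>2)" using q by algebra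
    moreover have "(1 + r)\<^sup>2 \<noteq> 0" using r by simp
    ultimately show ?thesis by (simp add: divide_simps)
  qed
  finally have "\<mu> * ((11 - 18 * r) / 64) \<le> lambda_const * ((11 - 18 * r) / 64)"
    unfolding r_def r0_const_quotients(2,3) by (simp add: algebra_simps)
  then show ?thesis using r by simp
qed

theorem theorem2p1:
  shows "(\<forall>f a z. bounded_series f a \<longrightarrow> cmod z \<le> r0_const \<longrightarrow> bohr_lhs lambda_const f a z \<le> 1)
    \<and> (\<forall>\<mu>>lambda_const.
          \<not> (\<forall>f a z. bounded_series f a \<longrightarrow> cmod z \<le> r0_const \<longrightarrow> bohr_lhs \<mu> f a z \<le> 1))
    \<and> (\<forall>R>r0_const.
          \<not> (\<forall>f a z. bounded_series f a \<longrightarrow> cmod z < 1 \<longrightarrow> cmod z \<le> R \<longrightarrow>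
                bohr_lhs lambda_const f a z \<le> 1))"
proof (intro conjI allI impI)
  show "bohr_lhs lambda_const f a z \<le> 1" if "bounded_series f a" "cmod z \<le> r0_const" for f a z
    using that by (rule bohr_lhs_le_1)
next
  fix \<mu> assume \<mu>: "lambda_const < \<mu>"
  show "\<not> (\<forall>f a z. bounded_series f a \<longrightarrow> cmod z \<le> r0_const \<longrightarrow> bohr_lhs \<mu> f a z \<le> 1)"
  proof
    assume le: "\<forall>f a z. bounded_series f a \<longrightarrow> cmod z \<le> r0_const \<longrightarrow> bohr_lhs \<mu> f a z \<le> 1"
    have "\<mu> \<le> lambda_const"
      using \<mu> lambda_const_nonneg r0_const_bounds le bounded_series_moebius
      by (intro lambda_necessary_condition) auto
    then show False using \<mu> by simp
  qed
next
  fix R assume R: "r0_const < R"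
  show "\<not> (\<forall>f a z. bounded_series f a \<longrightarrow> cmod z < 1 \<longrightarrow> cmod z \<le> R \<longrightarrow>
      bohr_lhs lambda_const f a z \<le> 1)"
  proof
    assume le: "\<forall>f a z. bounded_series f a \<longrightarrow> cmod z < 1 \<longrightarrow> cmod z \<le> R \<longrightarrow>
      bohr_lhs lambda_const f a z \<le> 1"
    \<comment> \<open>The test point must lie inside the unit disk even when R is 1 or
      larger.\<close>
    obtain r where r: "r0_const < r" "r < min R 1"
      using dense[of r0_const "min R 1"] R r0_const_bounds by auto
    have "r \<le> r0_const"
      using r r0_const_bounds le bounded_series_moebius
      by (intro radius_necessary_condition) auto
    then show False using r by simp
  qed
qed

end
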